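(* Let $A\in M_n(\mathbb{C})$ be normal with $m$ distinct eigenvalues $\lambda_1,\dots,\lambda_m$. Then $F_N(A)$ is the set enclosed by the hyperbolic arcs $H(\lambda_i,\lambda_j)$, $1\le i,j\le m$, $i\neq j$, along with any line segments that connect the points of tangency for a line bitangent to two arcs $H(\lambda_i,\lambda_j)$ and $H(\lambda_j,\lambda_k)$ that share an eigenvalue $\lambda_j$. This set is closed, except possibly at the origin if $A$ is not invertible and $0\notin\operatorname{conv}\{\lambda_i:\lambda_i\neq 0\}$.
   Context: $M_n(\mathbb{C})$ is the algebra of $n\times n$ complex matrices. The normalized numerical range of $A\in M_n(\mathbb{C})$ is $$F_N(A)=\left\{\frac{x^*Ax}{\|x\|\,\|Ax\|}: x\in\mathbb{C}^n,\ Ax\neq 0\right\}.$$ For distinct $\lambda,\mu\in\mathbb{C}$, $H(\lambda,\mu)$ denotes the normalized numerical range of a normal matrix with exactly the two distinct eigenvalues $\lambda$ and $\mu$ (it depends only on $\lambda$ and $\mu$). If $\lambda,\mu\neq0$, it is an arc of a hyperbola centered at the origin with endpoints $\lambda/|\lambda|$ and $\mu/|\mu|$; if $\mu=0$, it is the line segment $(0,\lambda/|\lambda|]$. The set enclosed by a family of curves consists of the curves together with the bounded regions they surround. $\operatorname{conv}$ denotes the convex hull.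
   Formalization: The enclosed-set description is stated for m ≥ 2 (for m = 1 there are no arcs, yet F_N(I) = {1}); when two eigenvalues lie on one ray from 0, so that H is a doubled segment, every line through its inner tip counts as tangent there (needed e.g. for eigenvalues 1, 4, 3i). *)

theory Defs
  imports "HOL-Analysis.Analysis"
begin

definition conj_transpose :: "complex^'n^'n \<Rightarrow> complex^'n^'n" where
  "conj_transpose A = (\<chi> i j. cnj (A $ j $ i))"

definition normal_matrix :: "complex^'n^'n \<Rightarrow> bool" where
  "normal_matrix A \<longleftrightarrow> A ** conj_transpose A = conj_transpose A ** A"

definition eigenvalues :: "complex^'n^'n \<Rightarrow> complex set" where
  "eigenvalues A = {z. \<exists>v. v \<noteq> 0 \<and> A *v v = z *s v}"

definition norm_num_range :: "complex^'n^'n \<Rightarrow> complex set" where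
  "norm_num_range A =
     {(\<Sum>i\<in>UNIV. cnj (x $ i) * (A *v x) $ i) / of_real (norm x * norm (A *v x)) | x. A *v x \<noteq> 0}"

definition diag2 :: "complex \<Rightarrow> complex \<Rightarrow> complex^2^2" where
  "diag2 a b = vector [vector [a, 0], vector [0, b]]"

text \<open>The normalized numerical range of a normal matrix is determined by its set of
  eigenvalues, so \<open>H(a,b)\<close> is represented by the matrix \<open>diag(a,b)\<close>; it is used for distinct
  \<open>a\<close> and \<open>b\<close> only.\<close>

definition hyp_arc :: "complex \<Rightarrow> complex \<Rightarrow> complex set" where
  "hyp_arc a b = norm_num_range (diag2 a b)"

lemma normal_diag2: "normal_matrix (diag2 a b)"
  by (simp add: normal_matrix_def conj_transpose_def diag2_def vec_eq_iff matrix_matrix_mult_def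
      forall_2 sum_2 mult.commute)

lemma diag2_mult: "(diag2 a b *v x) $ 1 = a * x $ 1" "(diag2 a b *v x) $ 2 = b * x $ 2"
  by (simp_all add: diag2_def matrix_vector_mult_def sum_2)

lemma eigenvalues_diag2: "eigenvalues (diag2 a b) = {a, b}"
proof -
  have "z \<in> eigenvalues (diag2 a b) \<longleftrightarrow> z \<in> {a, b}" for z
  proof -
    have "z \<in> eigenvalues (diag2 a b) \<longleftrightarrow>
        (\<exists>v::complex^2. (v $ 1 \<noteq> 0 \<or> v $ 2 \<noteq> 0) \<and> a * v $ 1 = z * v $ 1 \<and> b * v $ 2 = z * v $ 2)"
      by (simp add: eigenvalues_def vec_eq_iff forall_2 diag2_mult)
    also have "\<dots> \<longleftrightarrow> z = a \<or> z = b"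
    proof
      assume "z = a \<or> z = b"
      then show "\<exists>v::complex^2. (v $ 1 \<noteq> 0 \<or> v $ 2 \<noteq> 0) \<and> a * v $ 1 = z * v $ 1 \<and> b * v $ 2 = z * v $ 2"
      proof
        assume "z = a"
        then show ?thesis by (intro exI[of _ "vector [1, 0]"]) simp
      next
        assume "z = b"
        then show ?thesis by (intro exI[of _ "vector [0, 1]"]) simp
      qed
    qed auto
    finally show ?thesis by simp
  qed
  then show ?thesis by blast
qed

text \<open>The arc \<open>H(a,b)\<close> as a parametrized curve: the vector \<open>x\<close> with entries \<open>sqrt t\<close> and
  \<open>sqrt (1 - t)\<close> has \<open>x\<^sup>* A x = t a + (1 - t) b\<close> and \<open>\<parallel>A x\<parallel>\<^sup>2 = t |a|\<^sup>2 + (1 - t) |b|\<^sup>2\<close> for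
  \<open>A = diag(a,b)\<close>. The parameter interval is \<open>[0,1]\<close>, without the endpoint where \<open>A x = 0\<close>
  if \<open>a\<close> or \<open>b\<close> is zero.\<close>

definition arc_param :: "complex \<Rightarrow> complex \<Rightarrow> real \<Rightarrow> complex" where
  "arc_param a b t =
     (of_real t * a + of_real (1 - t) * b) / of_real (sqrt (t * (cmod a)\<^sup>2 + (1 - t) * (cmod b)\<^sup>2))"

definition arc_dom :: "complex \<Rightarrow> complex \<Rightarrow> real set" where
  "arc_dom a b = {t \<in> {0..1}. t * (cmod a)\<^sup>2 + (1 - t) * (cmod b)\<^sup>2 \<noteq> 0}"

lemma hyp_arc_eq_image: "hyp_arc a b = arc_param a b ` arc_dom a b"
proof
  let ?D = "diag2 a b"
  have nx: "norm x = sqrt ((cmod (x $ 1))\<^sup>2 + (cmod (x $ 2))\<^sup>2)" for x :: "complex^2"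
    by (simp add: norm_vec_def L2_set_def sum_2)
  have nAx: "norm (?D *v x) = sqrt ((cmod a)\<^sup>2 * (cmod (x $ 1))\<^sup>2 + (cmod b)\<^sup>2 * (cmod (x $ 2))\<^sup>2)" for x
    by (simp add: nx diag2_mult norm_mult power_mult_distrib)
  have cc: "cnj w * (z * w) = of_real ((cmod w)\<^sup>2) * z" for w z
    by (simp only: complex_norm_square mult_ac)
  have ip: "(\<Sum>i\<in>UNIV. cnj (x $ i) * (?D *v x) $ i)
      = of_real ((cmod (x $ 1))\<^sup>2) * a + of_real ((cmod (x $ 2))\<^sup>2) * b" for x
    by (simp only: sum_2 diag2_mult cc)
  show "hyp_arc a b \<subseteq> arc_param a b ` arc_dom a b"
  proof
    fix u assume "u \<in> hyp_arc a b"
    then obtain x where x: "?D *v x \<noteq> 0"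
      and u: "u = (\<Sum>i\<in>UNIV. cnj (x $ i) * (?D *v x) $ i) / of_real (norm x * norm (?D *v x))"
      by (auto simp: hyp_arc_def norm_num_range_def)
    define p q where "p = (cmod (x $ 1))\<^sup>2" and "q = (cmod (x $ 2))\<^sup>2"
    define s t where "s = p + q" and "t = p / s"
    have p: "p \<ge> 0" and q: "q \<ge> 0" by (simp_all add: p_def q_def)
    have "x \<noteq> 0" using x by auto
    then have "norm x > 0" by simp
    then have s: "s > 0" by (simp add: nx s_def p_def q_def)
    have t: "t \<in> {0..1}" using p q s by (auto simp: t_def s_def field_simps)
    have pt: "p = s * t" using s by (simp add: t_def)
    have qt: "q = s * (1 - t)" using pt by (simp add: s_def algebra_simps)
    define r where "r = t * (cmod a)\<^sup>2 + (1 - t) * (cmod b)\<^sup>2"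
    have "(cmod a)\<^sup>2 * p + (cmod b)\<^sup>2 * q = s * r"
      by (simp add: pt qt r_def algebra_simps)
    then have nA: "norm (?D *v x) = sqrt s * sqrt r"
      by (simp add: nAx p_def q_def flip: real_sqrt_mult)
    have nx': "norm x = sqrt s" by (simp add: nx s_def p_def q_def)
    have "r \<noteq> 0" using x nA by force
    have den: "norm x * norm (?D *v x) = s * sqrt r"
      using s by (simp add: nA nx' mult.assoc[symmetric])
    have "u = (of_real p * a + of_real q * b) / of_real (s * sqrt r)"
      by (simp only: u ip den p_def q_def)
    also have "\<dots> = (of_real s * (of_real t * a + of_real (1 - t) * b)) / (of_real s * of_real (sqrt r))"
      by (simp add: pt qt algebra_simps)
    also have "\<dots> = (of_real t * a + of_real (1 - t) * b) / of_real (sqrt r)"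
      by (subst mult_divide_mult_cancel_left) (use s in simp_all)
    also have "\<dots> = arc_param a b t"
      unfolding arc_param_def r_def ..
    finally have "u = arc_param a b t" .
    moreover have "t \<in> arc_dom a b" using t \<open>r \<noteq> 0\<close> by (simp add: arc_dom_def r_def)
    ultimately show "u \<in> arc_param a b ` arc_dom a b" by blast
  qed
  show "arc_param a b ` arc_dom a b \<subseteq> hyp_arc a b"
  proof clarify
    fix t assume t: "t \<in> arc_dom a b"
    define x :: "complex^2" where "x = vector [of_real (sqrt t), of_real (sqrt (1 - t))]"
    have x12: "(cmod (x $ 1))\<^sup>2 = t" "(cmod (x $ 2))\<^sup>2 = 1 - t"
      using t by (simp_all add: x_def arc_dom_def)
    have nA: "norm (?D *v x) = sqrt (t * (cmod a)\<^sup>2 + (1 - t) * (cmod b)\<^sup>2)"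
      by (simp only: nAx x12 mult.commute)
    then have "?D *v x \<noteq> 0" using t by (auto simp: arc_dom_def)
    moreover have "norm x = 1" by (simp add: nx x12)
    moreover have "arc_param a b t
        = (\<Sum>i\<in>UNIV. cnj (x $ i) * (?D *v x) $ i) / of_real (norm x * norm (?D *v x))"
      unfolding ip nA x12 arc_param_def \<open>norm x = 1\<close> by simp
    ultimately show "arc_param a b t \<in> hyp_arc a b"
      unfolding hyp_arc_def norm_num_range_def by blast
  qed
qed

text \<open>The line \<open>L\<close> is tangent to the arc \<open>H(a,b)\<close> at its point \<open>p\<close>: it passes through \<open>p\<close> in
  the direction of the derivative of the parametrized arc (one-sided at an endpoint, which
  belongs to the arc). The derivative vanishes only when \<open>a\<close> and \<open>b\<close> lie on one ray from the
  origin, at the point of \<open>H(a,b)\<close> nearest to the origin: the hyperbolic arc then degenerates to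
  a segment traversed back and forth, and every line through its turning point is tangent
  there (for nearby \<open>a\<close>, \<open>b\<close> on different rays the tangents at points near the vertex
  sweep out almost all directions).\<close>

definition tangent_line_at :: "complex set \<Rightarrow> complex \<Rightarrow> complex \<Rightarrow> complex \<Rightarrow> bool" where
  "tangent_line_at L a b p \<longleftrightarrow> affine L \<and> aff_dim L = 1 \<and>
     (\<exists>t \<in> arc_dom a b. \<exists>v. p = arc_param a b t \<and>
        (arc_param a b has_vector_derivative v) (at t within arc_dom a b) \<and>
        p \<in> L \<and> p + v \<in> L)"

definition arcs :: "complex set \<Rightarrow> complex set set" where
  "arcs S = {hyp_arc a b | a b. a \<in> S \<and> b \<in> S \<and> a \<noteq> b}"

definition bitangent_segments :: "complex set \<Rightarrow> complex set set" where
  "bitangent_segments S = {closed_segment p q | p q. \<exists>L a b c.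
     a \<in> S \<and> b \<in> S \<and> c \<in> S \<and> a \<noteq> b \<and> b \<noteq> c \<and> a \<noteq> c \<and>
     tangent_line_at L a b p \<and> tangent_line_at L b c q}"

text \<open>The curves of a family together with the bounded regions surrounded by curves of the
  family. The regions are the bounded components of the complement of the closure of
  the curves used: the arcs \<open>H(a,0)\<close> lack their endpoint \<open>0\<close>, and without the closure a region
  with \<open>0\<close> on its boundary would be joined to the outside through this point. The
  subfamilies matter only for points in the closure of the union of all the curves, that is,
  for whether a missing endpoint \<open>0\<close> is itself surrounded by other curves.\<close>

definition enclosed :: "complex set set \<Rightarrow> complex set" where
  "enclosed C = \<Union>C \<union> (\<Union>D \<in> Pow C. inside (closure (\<Union>D)))"

lemma enclosed_closed:
  assumes "closed (\<Union>C)"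
  shows "enclosed C = \<Union>C \<union> inside (\<Union>C)"
proof -
  have "inside (closure (\<Union>D)) \<subseteq> \<Union>C \<union> inside (\<Union>C)" if "D \<subseteq> C" for D
  proof -
    have "closure (\<Union>D) \<subseteq> \<Union>C" using that assms by (intro closure_minimal) auto
    then show ?thesis using inside_mono by blast
  qed
  moreover have "inside (\<Union>C) \<subseteq> enclosed C"
    using assms unfolding enclosed_def by (auto intro!: exI[of _ C] bexI[of _ C])
  ultimately show ?thesis unfolding enclosed_def by blast
qed

end

theory Submission
  imports Defs "HOL-Computational_Algebra.Fundamental_Theorem_Algebra"
begin

text \<open>
  An orthogonal eigenvector decomposition turns the quotient \<open>x\<^sup>* A x / (\<parallel>x\<parallel> \<parallel>A x\<parallel>)\<close> of a normal
  matrix into \<open>z / sqrt h\<close>, where \<open>(z, h)\<close> is the convex combination of the points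
  \<open>(l, |l|\<^sup>2)\<close>, \<open>l\<close> an eigenvalue, with weights \<open>\<parallel>x\<^sub>l\<parallel>\<^sup>2 / \<parallel>x\<parallel>\<^sup>2\<close>. So the normalized numerical
  range is the image of a polytope \<open>K\<close> in \<open>\<complex> \<times> \<real>\<close>, whose vertices lie on a paraboloid, under
  \<open>(z, h) \<mapsto> z / sqrt h\<close> (\<open>norm_num_range_normal\<close>). The fibre of this map over \<open>w\<close> is the
  half-parabola \<open>s \<mapsto> (s w, s\<^sup>2)\<close>, \<open>s > 0\<close>, and the images of the edges joining two vertices are
  the arcs \<open>H(a,b)\<close>. Everything else is a question of how such parabolas meet \<open>K\<close>.

  Suppose that the parabola of \<open>w\<close> meets \<open>K\<close> at \<open>k\<close>, and write \<open>k\<close> as a convex combination of as few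
  vertices as possible. Four vertices make \<open>k\<close> interior to \<open>K\<close>, and \<open>w\<close> is interior to the range.
  One or two vertices put \<open>w\<close> on an arc. With three vertices, \<open>k\<close> lies inside a triangle. If the
  parabola crosses the plane of the triangle transversally, so do the parabolas of all points near
  \<open>w\<close>, and \<open>w\<close> is again interior. If it is tangent to the plane without lying in it, then
  tangency happens at one fixed height \<open>s\<^sup>2\<close>; the points \<open>w\<close> in question fill the horizontal section
  of the triangle at that height, scaled by \<open>1 / s\<close>, and this is a segment that is tangent to two arcs
  at its ends. If the parabola lies in the plane, it leaves the triangle through an edge, so that
  \<open>w\<close> is on an arc. Hence a point of the range that is not interior to it lies on one of
  finitely many curves of the family (\<open>spectral_range_interior_or_curve\<close>), the frontier of the
  range is covered by the closure of these curves, and every remaining point of the range is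
  surrounded by them (\<open>spectral_range_subset_enclosed\<close>).

  For the converse, the arcs lie in the range by construction and the bitangent segments by
  \<open>bitangent_segment_subset\<close>. Nothing outside of the range is surrounded by these curves
  (\<open>inside_subset_spectral_range\<close>): the range meets each ray from the origin in an interval, which
  reaches down to the origin unless the range lies in an open half plane, so every point
  outside can escape to infinity along its ray, outward or through the origin.

  Without a zero eigenvalue \<open>h\<close> is positive on the compact set \<open>K\<close>, so the range is compact. A zero eigenvalue turns the range \<open>R\<close>
  of the other eigenvalues into the set of all \<open>r w\<close> with \<open>0 < r \<le> 1\<close> and \<open>w \<in> R\<close>, which can only lack
  the limit point \<open>0\<close>.
\<close>

section \<open>Orthogonal eigenvector decomposition for normal matrices\<close>

definition hermitian_inner :: "complex^'n \<Rightarrow> complex^'n \<Rightarrow> complex" where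
  "hermitian_inner x y = (\<Sum>i\<in>UNIV. cnj (x $ i) * y $ i)"

lemma hermitian_inner_sum_left: "hermitian_inner (\<Sum>k\<in>I. f k) y = (\<Sum>k\<in>I. hermitian_inner (f k) y)"
  unfolding hermitian_inner_def by (simp add: sum_component cnj_sum sum_distrib_right) (rule sum.swap)

lemma hermitian_inner_sum_right: "hermitian_inner x (\<Sum>k\<in>I. f k) = (\<Sum>k\<in>I. hermitian_inner x (f k))"
  unfolding hermitian_inner_def by (simp add: sum_component sum_distrib_left) (rule sum.swap)

lemma hermitian_inner_scale_left: "hermitian_inner (c *s x) y = cnj c * hermitian_inner x y"
  by (simp add: hermitian_inner_def sum_distrib_left mult_ac)

lemma hermitian_inner_scale_right: "hermitian_inner x (c *s y) = c * hermitian_inner x y"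
  by (simp add: hermitian_inner_def sum_distrib_left mult_ac)

lemma hermitian_inner_self: "hermitian_inner x x = of_real ((norm x)\<^sup>2)"
proof -
  have "hermitian_inner x x = (\<Sum>i\<in>UNIV. of_real ((cmod (x $ i))\<^sup>2))"
    unfolding hermitian_inner_def by (intro sum.cong refl) (simp only: complex_norm_square mult.commute)
  then show ?thesis
    by (simp add: norm_vec_def L2_set_def sum_nonneg)
qed

lemma hermitian_inner_adjoint: "hermitian_inner (A *v x) y = hermitian_inner x (conj_transpose A *v y)"
  unfolding hermitian_inner_def matrix_vector_mult_def conj_transpose_def
  by (simp add: sum_distrib_left sum_distrib_right cnj_sum mult_ac) (rule sum.swap)

lemma conj_transpose_conj_transpose: "conj_transpose (conj_transpose A) = A"
  by (simp add: conj_transpose_def vec_eq_iff)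

lemma hermitian_inner_diff_left: "hermitian_inner (x - y) z = hermitian_inner x z - hermitian_inner y z"
  by (simp add: hermitian_inner_def left_diff_distrib sum_subtractf)

lemma hermitian_inner_diff_right: "hermitian_inner x (y - z) = hermitian_inner x y - hermitian_inner x z"
  by (simp add: hermitian_inner_def right_diff_distrib sum_subtractf)

lemma hermitian_inner_shifted_adjoint:
  "hermitian_inner (A *v x - c *s x) y = hermitian_inner x (conj_transpose A *v y - cnj c *s y)"
  by (simp add: hermitian_inner_diff_left hermitian_inner_diff_right hermitian_inner_adjoint
      hermitian_inner_scale_left hermitian_inner_scale_right)

text \<open>Shifting by a scalar preserves normality: \<open>B = A - c\<close> and \<open>A\<^sup>* - cnj c\<close> commute and are
  adjoint to each other, and therefore stretch every vector by the same factor. In particular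
  eigenvectors of \<open>A\<close> are eigenvectors of the adjoint.\<close>

lemma normal_shifted_norm:
  assumes "normal_matrix A"
  shows "norm (conj_transpose A *v x - cnj c *s x) = norm (A *v x - c *s x)"
proof -
  let ?B = "\<lambda>x. A *v x - c *s x" and ?B' = "\<lambda>x. conj_transpose A *v x - cnj c *s x"
  have "A *v (conj_transpose A *v x) = conj_transpose A *v (A *v x)"
    using assms by (simp add: normal_matrix_def matrix_vector_mul_assoc)
  then have comm: "?B (?B' x) = ?B' (?B x)"
    by (simp add: matrix_vector_mult_diff_distrib vector_scalar_commute vector_smult_assoc
        vector_ssub_ldistrib mult.commute)
  have adj: "hermitian_inner (?B' x) y = hermitian_inner x (?B y)" for y
    using hermitian_inner_shifted_adjoint [of "conj_transpose A" x "cnj c" y]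
    by (simp add: conj_transpose_conj_transpose)
  have "hermitian_inner (?B' x) (?B' x) = hermitian_inner x (?B (?B' x))" by (rule adj)
  also have "\<dots> = hermitian_inner (?B x) (?B x)" unfolding comm hermitian_inner_shifted_adjoint ..
  finally have "hermitian_inner (?B' x) (?B' x) = hermitian_inner (?B x) (?B x)" .
  then show ?thesis by (simp add: hermitian_inner_self flip: of_real_power)
qed

text \<open>This is diagonalizability in the form \<open>(A - c)\<^sup>2 x = 0 \<Longrightarrow> (A - c) x = 0\<close>. Since \<open>y\<close> is also
  killed by the adjoint of \<open>A - c\<close> and lies in the range of \<open>A - c\<close>, it is orthogonal to itself.\<close>

lemma normal_shifted_kernel_square:
  assumes "normal_matrix A" and "y = A *v x - c *s x" and "A *v y = c *s y"
  shows "y = 0"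
proof -
  have "norm (conj_transpose A *v y - cnj c *s y) = 0"
    using normal_shifted_norm [OF assms(1), of y c] assms(3) by simp
  then have "conj_transpose A *v y - cnj c *s y = 0"
    by simp
  then have "hermitian_inner y y = 0"
    using hermitian_inner_shifted_adjoint [of A x c y] by (simp add: assms(2) hermitian_inner_def)
  then show ?thesis by (simp add: hermitian_inner_self)
qed

lemma normal_adjoint_eigenvector:
  assumes "normal_matrix A" and "A *v x = c *s x"
  shows "conj_transpose A *v x = cnj c *s x"
  using normal_shifted_norm [OF assms(1), of x c] assms(2) by simp

lemma normal_eigenvectors_orthogonal:
  assumes "normal_matrix A" and x: "A *v x = c *s x" and y: "A *v y = d *s y" and "c \<noteq> d"
  shows "hermitian_inner x y = 0"
proof -
  have "d * hermitian_inner x y = hermitian_inner x (A *v y)" by (simp add: y hermitian_inner_scale_right)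
  also have "\<dots> = hermitian_inner (conj_transpose A *v x) y" by (simp add: hermitian_inner_adjoint conj_transpose_conj_transpose)
  also have "\<dots> = c * hermitian_inner x y"
    by (simp add: normal_adjoint_eigenvector [OF assms(1) x] hermitian_inner_scale_left)
  finally show ?thesis using \<open>c \<noteq> d\<close> by simp
qed

lemma matrix_vector_mult_sum: "A *v (\<Sum>k\<in>I. f k) = (\<Sum>k\<in>I. A *v f k)"
  by (simp add: matrix_vector_mult_def vec_eq_iff sum_component sum_distrib_left) (rule allI, rule sum.swap)

definition poly_apply :: "complex^'n^'n \<Rightarrow> complex poly \<Rightarrow> complex^'n \<Rightarrow> complex^'n" where
  "poly_apply A p x = (\<Sum>i\<le>degree p. coeff p i *s (((*v) A ^^ i) x))"

lemma poly_apply_bound: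
  assumes "degree p \<le> N"
  shows "poly_apply A p x = (\<Sum>i\<le>N. coeff p i *s (((*v) A ^^ i) x))"
  unfolding poly_apply_def
  by (rule sum.mono_neutral_left) (use assms in \<open>auto simp: coeff_eq_0\<close>)

lemma poly_apply_linear_factor:
  "poly_apply A ([:- c, 1:] * q) x = poly_apply A q (A *v x - c *s x)"
proof -
  define N where "N = Suc (degree q)"
  have pw: "((*v) A ^^ i) (A *v x - c *s x) = ((*v) A ^^ Suc i) x - c *s ((*v) A ^^ i) x" for i
    by (induction i) (simp_all add: matrix_vector_mult_diff_distrib vector_scalar_commute)
  have "degree ([:- c, 1:] * q) \<le> N"
    unfolding N_def by (rule order_trans [OF degree_mult_le]) simp
  then have "poly_apply A ([:- c, 1:] * q) x
      = (\<Sum>i\<le>N. coeff ([:- c, 1:] * q) i *s ((*v) A ^^ i) x)"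
    by (rule poly_apply_bound)
  also have "\<dots> = (\<Sum>i\<le>N. coeff (pCons 0 q) i *s ((*v) A ^^ i) x) - (\<Sum>i\<le>N. (c * coeff q i) *s ((*v) A ^^ i) x)"
    by (simp add: algebra_simps vector_sub_rdistrib flip: sum_subtractf)
  also have "(\<Sum>i\<le>N. coeff (pCons 0 q) i *s ((*v) A ^^ i) x)
      = (\<Sum>i\<le>degree q. coeff q i *s ((*v) A ^^ Suc i) x)"
    unfolding N_def sum.atMost_Suc_shift by simp
  also have "(\<Sum>i\<le>N. (c * coeff q i) *s ((*v) A ^^ i) x)
      = (\<Sum>i\<le>degree q. coeff q i *s (c *s ((*v) A ^^ i) x))"
    unfolding N_def by (simp add: coeff_eq_0 vector_smult_assoc mult.commute)
  finally show ?thesis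
    unfolding poly_apply_def pw by (simp add: vector_ssub_ldistrib sum_subtractf)
qed

text \<open>The vectors \<open>x, A x, A\<^sup>2 x, \<dots>\<close> live in a space of finite real dimension, so that more of them
  than that dimension satisfy a linear relation; a repetition among them is a relation as well.\<close>

lemma annihilating_polynomial:
  obtains p where "p \<noteq> 0" "poly_apply A p x = 0"
proof -
  let ?f = "\<lambda>i. ((*v) A ^^ i) x"
  note found = that
  have *: thesis if "finite I" "k \<in> I" "c k \<noteq> (0::real)" "(\<Sum>i\<in>I. c i *\<^sub>R ?f i) = 0" for c k I
  proof -
    define p where "p = (\<Sum>i\<in>I. monom (complex_of_real (c i)) i)"
    have cp: "coeff p i = (if i \<in> I then of_real (c i) else 0)" for i
      using that(1) by (simp add: p_def coeff_sum sum.delta cong: if_cong)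
    have "coeff p k \<noteq> 0" using cp that by simp
    then have p: "p \<noteq> 0" by auto
    have "poly_apply A p x = (\<Sum>i\<in>{..degree p} \<union> I. coeff p i *s ?f i)"
      unfolding poly_apply_def
      by (rule sum.mono_neutral_left) (use that(1) in \<open>auto simp: coeff_eq_0\<close>)
    also have "\<dots> = (\<Sum>i\<in>I. coeff p i *s ?f i)"
      by (rule sum.mono_neutral_right) (use that(1) cp in auto)
    also have "\<dots> = (\<Sum>i\<in>I. c i *\<^sub>R ?f i)"
      by (rule sum.cong) (auto simp: cp vec_eq_iff scaleR_conv_of_real [where 'a = complex])
    finally have "poly_apply A p x = 0" using that by simp
    with p show thesis by (rule found)
  qed
  let ?N = "DIM(complex^'a)"
  show thesis
  proof (cases "inj_on ?f {..?N}")
    case False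
    then obtain i j where ij: "i \<noteq> j" "?f i = ?f j" by (auto simp: inj_on_def)
    show thesis
      by (rule * [of "{i, j}" i "\<lambda>k. if k = i then 1 else -1"]) (use ij in auto)
  next
    case True
    then have "card (?f ` {..?N}) > DIM(complex^'a)" by (simp add: card_image)
    then have "dependent (?f ` {..?N})" by (intro dependent_biggerset) auto
    then obtain u v where u: "v \<in> ?f ` {..?N}" "u v \<noteq> 0" "(\<Sum>v\<in>?f ` {..?N}. u v *\<^sub>R v) = 0"
      by (auto simp: dependent_finite)
    then obtain k where k: "k \<le> ?N" "v = ?f k" by auto
    have "(\<Sum>i\<le>?N. u (?f i) *\<^sub>R ?f i) = 0"
      using u(3) unfolding sum.reindex [OF True] comp_def .
    then show thesis
      by (intro * [of "{..?N}" k "\<lambda>i. u (?f i)"]) (use u k in auto)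
  qed
qed

text \<open>Induction on the degree of an annihilating polynomial of \<open>x\<close>. Splitting off a root \<open>c\<close>
  gives a decomposition of \<open>A x - c x\<close>. On the components for eigenvalues \<open>l \<noteq> c\<close> the operator \<open>A - c\<close>
  is inverted by division by \<open>l - c\<close>; the remainder of \<open>x\<close> is killed by \<open>(A - c)\<^sup>2\<close>, hence by \<open>A - c\<close>,
  and is the component for \<open>c\<close> itself.\<close>

lemma normal_eigenvector_decomposition_poly:
  assumes "normal_matrix A" and fin: "finite (eigenvalues A)"
  shows "p \<noteq> 0 \<Longrightarrow> poly_apply A p x = 0 \<Longrightarrow>
    \<exists>f. (\<forall>l. A *v f l = l *s f l) \<and> x = (\<Sum>l\<in>eigenvalues A. f l)"
proof (induction "degree p" arbitrary: p x)
  case 0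
  then obtain c where "p = [:c:]" "c \<noteq> 0" by (metis degree_eq_zeroE pCons_0_0)
  then have "x = 0" using 0 by (simp add: poly_apply_def)
  then show ?case by (intro exI [of _ "\<lambda>_. 0"]) simp
next
  case (Suc d)
  have "\<not> constant (poly p)" using Suc.hyps(2) by (simp add: constant_degree)
  then obtain c where "poly p c = 0" using fundamental_theorem_of_algebra by blast
  then obtain q where q: "p = [:- c, 1:] * q" by (auto simp: poly_eq_0_iff_dvd)
  then have "q \<noteq> 0" using Suc.prems by auto
  then have "degree p = Suc (degree q)" unfolding q by (subst degree_mult_eq) auto
  then have "d = degree q" using Suc.hyps(2) by simp
  from Suc.hyps(1) [OF this \<open>q \<noteq> 0\<close>, of "A *v x - c *s x"] Suc.prems(2)
  obtain f where f: "\<And>l. A *v f l = l *s f l" and s: "A *v x - c *s x = (\<Sum>l\<in>eigenvalues A. f l)"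
    unfolding q poly_apply_linear_factor by blast
  let ?E = "eigenvalues A"
  define g where "g l = (1 / (l - c)) *s f l" for l
  have g: "A *v g l = l *s g l" for l
    by (simp add: g_def f vector_scalar_commute vector_smult_assoc mult.commute)
  have gs: "A *v g l - c *s g l = f l" if "l \<noteq> c" for l
    using that unfolding g by (simp add: g_def vec_eq_iff diff_divide_distrib [symmetric] left_diff_distrib [symmetric])
  define z where "z = x - (\<Sum>l\<in>?E - {c}. g l)"
  have "A *v (\<Sum>l\<in>?E - {c}. g l) - c *s (\<Sum>l\<in>?E - {c}. g l) = (\<Sum>l\<in>?E - {c}. A *v g l - c *s g l)"
    by (simp add: matrix_vector_mult_sum sum_subtractf vec_eq_iff sum_component sum_distrib_left)
  also have "\<dots> = (\<Sum>l\<in>?E - {c}. f l)" by (rule sum.cong) (auto simp: gs)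
  finally have *: "A *v (\<Sum>l\<in>?E - {c}. g l) - c *s (\<Sum>l\<in>?E - {c}. g l) = (\<Sum>l\<in>?E - {c}. f l)" .
  have "A *v z - c *s z = (A *v x - c *s x) - (A *v (\<Sum>l\<in>?E - {c}. g l) - c *s (\<Sum>l\<in>?E - {c}. g l))"
    by (simp add: z_def matrix_vector_mult_diff_distrib vector_ssub_ldistrib)
  then have "A *v z - c *s z = (\<Sum>l\<in>?E. f l) - (\<Sum>l\<in>?E - {c}. f l)"
    unfolding s * .
  then have "A *v z - c *s z = (if c \<in> ?E then f c else 0)"
    using fin by (simp add: sum.remove)
  then have "A *v (A *v z - c *s z) = c *s (A *v z - c *s z)"
    by (auto simp: f)
  then have "A *v z - c *s z = 0" using normal_shifted_kernel_square [OF assms(1) refl] by blast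
  then have z: "A *v z = c *s z" by simp
  define h where "h l = (if l = c then z else g l)" for l
  have "x = (\<Sum>l\<in>?E. h l)"
  proof (cases "c \<in> ?E")
    case True
    then have "(\<Sum>l\<in>?E. h l) = h c + (\<Sum>l\<in>?E - {c}. h l)" using fin by (simp add: sum.remove)
    also have "(\<Sum>l\<in>?E - {c}. h l) = (\<Sum>l\<in>?E - {c}. g l)" by (rule sum.cong) (auto simp: h_def)
    finally show ?thesis by (simp add: h_def z_def)
  next
    case False
    then have "z = 0" using z by (auto simp: eigenvalues_def)
    moreover have "(\<Sum>l\<in>?E. h l) = (\<Sum>l\<in>?E. g l)" using False by (intro sum.cong) (auto simp: h_def)
    ultimately show ?thesis using False by (simp add: z_def)
  qed
  moreover have "A *v h l = l *s h l" for l using z g by (simp add: h_def)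
  ultimately show ?case by blast
qed

lemma normal_eigenvector_decomposition:
  assumes "normal_matrix A" and "finite (eigenvalues A)"
  obtains f where "\<And>l. A *v f l = l *s f l" "x = (\<Sum>l\<in>eigenvalues A. f l)"
  by (metis annihilating_polynomial normal_eigenvector_decomposition_poly [OF assms])

lemma hermitian_inner_eigenvector_sums:
  assumes "normal_matrix A" and "finite I" and f: "\<And>l. l \<in> I \<Longrightarrow> A *v f l = l *s f l"
  shows "hermitian_inner (\<Sum>l\<in>I. a l *s f l) (\<Sum>l\<in>I. b l *s f l)
       = (\<Sum>l\<in>I. cnj (a l) * b l * of_real ((norm (f l))\<^sup>2))"
proof -
  have "hermitian_inner (a l *s f l) (b k *s f k)
      = (if l = k then cnj (a l) * b l * of_real ((norm (f l))\<^sup>2) else 0)"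
    if "l \<in> I" "k \<in> I" for l k
    using that
    by (simp add: hermitian_inner_scale_left hermitian_inner_scale_right hermitian_inner_self normal_eigenvectors_orthogonal [OF assms(1) f f])
  then have "hermitian_inner (\<Sum>l\<in>I. a l *s f l) (\<Sum>l\<in>I. b l *s f l)
      = (\<Sum>l\<in>I. \<Sum>k\<in>I. if l = k then cnj (a l) * b l * of_real ((norm (f l))\<^sup>2) else 0)"
    by (subst hermitian_inner_sum_left, subst hermitian_inner_sum_right) (auto intro!: sum.cong)
  then show ?thesis using \<open>finite I\<close> by simp
qed

section \<open>The range of a spectrum\<close>

text \<open>The lift to the paraboloid records, besides the eigenvalue, the quantity that enters
  \<open>\<parallel>A x\<parallel>\<^sup>2\<close> linearly in the weights.\<close>

definition lift :: "complex \<Rightarrow> complex \<times> real" where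
  "lift l = (l, (cmod l)\<^sup>2)"

definition ratio :: "complex \<times> real \<Rightarrow> complex" where
  "ratio k = fst k /\<^sub>R sqrt (snd k)"

text \<open>The condition \<open>snd k > 0\<close> stands for \<open>A x \<noteq> 0\<close>; it excludes at most the lift of the eigenvalue
  zero.\<close>

definition spectral_range :: "complex set \<Rightarrow> complex set" where
  "spectral_range S = ratio ` {k \<in> convex hull (lift ` S). snd k > 0}"

lemma inj_lift: "inj_on lift S"
  by (auto simp: inj_on_def lift_def)

lemma convex_hull_lift:
  assumes "finite S"
  shows "convex hull (lift ` S) =
    {(\<Sum>l\<in>S. t l *\<^sub>R l, \<Sum>l\<in>S. t l * (cmod l)\<^sup>2) | t. (\<forall>l\<in>S. 0 \<le> t l) \<and> sum t S = 1}"
proof -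
  have eq: "(\<Sum>l\<in>S. t l *\<^sub>R lift l) = (\<Sum>l\<in>S. t l *\<^sub>R l, \<Sum>l\<in>S. t l * (cmod l)\<^sup>2)" for t
    by (simp add: prod_eq_iff fst_sum snd_sum) (simp add: lift_def)
  have fin: "finite (lift ` S)" using assms by simp
  have "\<exists>t. (\<forall>l\<in>S. 0 \<le> t l) \<and> sum t S = 1 \<and>
      k = (\<Sum>l\<in>S. t l *\<^sub>R l, \<Sum>l\<in>S. t l * (cmod l)\<^sup>2)" if k: "k \<in> convex hull (lift ` S)" for k
  proof -
    from k obtain u where "\<forall>x\<in>lift ` S. 0 \<le> u x" "sum u (lift ` S) = 1" "(\<Sum>x\<in>lift ` S. u x *\<^sub>R x) = k"
      unfolding convex_hull_finite [OF fin] by auto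
    then show ?thesis
      by (intro exI [of _ "u \<circ> lift"]) (auto simp: sum.reindex [OF inj_lift] eq comp_def)
  qed
  moreover have "(\<Sum>l\<in>S. t l *\<^sub>R l, \<Sum>l\<in>S. t l * (cmod l)\<^sup>2) \<in> convex hull (lift ` S)"
    if "\<forall>l\<in>S. 0 \<le> t l" "sum t S = 1" for t
    unfolding convex_hull_finite [OF fin] mem_Collect_eq
    by (rule exI [of _ "t \<circ> fst"])
       (use that in \<open>simp add: sum.reindex [OF inj_lift] eq [symmetric], simp add: lift_def\<close>)
  ultimately show ?thesis by blast
qed

text \<open>The weights of a unit vector are the squared norms of its components in the eigenspaces, and
  all weights occur: combine unit eigenvectors with coefficients \<open>sqrt (t l)\<close>.\<close>

lemma norm_num_range_normal:
  assumes A: "normal_matrix A" and fin: "finite (eigenvalues A)"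
  shows "norm_num_range A = spectral_range (eigenvalues A)"
proof
  let ?E = "eigenvalues A"
  have nnr: "norm_num_range A = {hermitian_inner x (A *v x) / of_real (norm x * norm (A *v x)) | x. A *v x \<noteq> 0}"
    by (simp add: norm_num_range_def hermitian_inner_def)
  have quot: "hermitian_inner x (A *v x) = (\<Sum>l\<in>?E. (norm (f l))\<^sup>2 *\<^sub>R l)"
      "(norm x)\<^sup>2 = (\<Sum>l\<in>?E. (norm (f l))\<^sup>2)"
      "(norm (A *v x))\<^sup>2 = (\<Sum>l\<in>?E. (norm (f l))\<^sup>2 * (cmod l)\<^sup>2)"
    if f: "\<And>l. l \<in> ?E \<Longrightarrow> A *v f l = l *s f l" and x: "x = (\<Sum>l\<in>?E. f l)" for x f
  proof -
    note * = hermitian_inner_eigenvector_sums [OF A fin f]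
    have x1: "x = (\<Sum>l\<in>?E. 1 *s f l)" by (simp add: x)
    have Ax: "A *v x = (\<Sum>l\<in>?E. l *s f l)"
      unfolding x matrix_vector_mult_sum by (rule sum.cong) (auto simp: f)
    show "hermitian_inner x (A *v x) = (\<Sum>l\<in>?E. (norm (f l))\<^sup>2 *\<^sub>R l)"
      unfolding Ax by (subst x1, subst *) (simp_all add: scaleR_conv_of_real mult.commute)
    have "of_real ((norm x)\<^sup>2) = hermitian_inner (\<Sum>l\<in>?E. 1 *s f l) (\<Sum>l\<in>?E. 1 *s f l)"
      by (simp only: hermitian_inner_self x1 [symmetric])
    also have "\<dots> = of_real (\<Sum>l\<in>?E. (norm (f l))\<^sup>2)" by (subst *) simp_all
    finally show "(norm x)\<^sup>2 = (\<Sum>l\<in>?E. (norm (f l))\<^sup>2)" by (simp only: of_real_eq_iff)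
    have "of_real ((norm (A *v x))\<^sup>2) = hermitian_inner (\<Sum>l\<in>?E. l *s f l) (\<Sum>l\<in>?E. l *s f l)"
      by (simp only: hermitian_inner_self Ax)
    also have "\<dots> = (\<Sum>l\<in>?E. of_real ((norm (f l))\<^sup>2 * (cmod l)\<^sup>2))"
      by (subst *) (auto intro!: sum.cong simp: complex_norm_square mult_ac simp del: of_real_power)
    also have "\<dots> = of_real (\<Sum>l\<in>?E. (norm (f l))\<^sup>2 * (cmod l)\<^sup>2)" by simp
    finally show "(norm (A *v x))\<^sup>2 = (\<Sum>l\<in>?E. (norm (f l))\<^sup>2 * (cmod l)\<^sup>2)"
      by (simp only: of_real_eq_iff)
  qed
  show "norm_num_range A \<subseteq> spectral_range ?E"
  proof
    fix w assume "w \<in> norm_num_range A"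
    then obtain x where x: "A *v x \<noteq> 0" and w: "w = hermitian_inner x (A *v x) / of_real (norm x * norm (A *v x))"
      by (auto simp: nnr)
    obtain f where f: "\<And>l. A *v f l = l *s f l" and xf: "x = (\<Sum>l\<in>?E. f l)"
      using normal_eigenvector_decomposition [OF A fin] by blast
    note q = quot [OF f xf]
    have "x \<noteq> 0" using x by auto
    then have nx: "norm x > 0" by simp
    define t where "t l = (norm (f l))\<^sup>2 / (norm x)\<^sup>2" for l
    define k where "k = (\<Sum>l\<in>?E. t l *\<^sub>R l, \<Sum>l\<in>?E. t l * (cmod l)\<^sup>2)"
    have "sum t ?E = 1"
      unfolding t_def sum_divide_distrib [symmetric] q(2) [symmetric] using nx by simp
    then have "k \<in> convex hull (lift ` ?E)"
      unfolding convex_hull_lift [OF fin] k_def using t_def by force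
    moreover have fk: "fst k = hermitian_inner x (A *v x) /\<^sub>R (norm x)\<^sup>2"
      by (simp add: k_def q(1) t_def scaleR_right.sum divide_inverse mult.commute)
    moreover have sk: "snd k = (norm (A *v x) / norm x)\<^sup>2"
      by (simp add: k_def q(3) t_def sum_divide_distrib power_divide)
    moreover have "snd k > 0" using x nx sk by simp
    moreover have "sqrt (snd k) = norm (A *v x) / norm x" unfolding sk by (simp add: real_sqrt_divide)
    then have "w = ratio k"
      using nx by (simp add: ratio_def fk w \<open>sqrt (snd k) = norm (A *v x) / norm x\<close> scaleR_conv_of_real field_simps power2_eq_square)
    ultimately show "w \<in> spectral_range ?E" by (auto simp: spectral_range_def)
  qed
  show "spectral_range ?E \<subseteq> norm_num_range A"
  proof
    fix w assume "w \<in> spectral_range ?E"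
    then obtain k where k: "k \<in> convex hull (lift ` ?E)" "snd k > 0" "w = ratio k"
      by (auto simp: spectral_range_def)
    then obtain t where t: "\<And>l. l \<in> ?E \<Longrightarrow> 0 \<le> t l" "sum t ?E = 1"
      and kt: "k = (\<Sum>l\<in>?E. t l *\<^sub>R l, \<Sum>l\<in>?E. t l * (cmod l)\<^sup>2)"
      unfolding convex_hull_lift [OF fin] by blast
    have h: "(\<Sum>l\<in>?E. t l * (cmod l)\<^sup>2) > 0"
      and w: "w = ratio (\<Sum>l\<in>?E. t l *\<^sub>R l, \<Sum>l\<in>?E. t l * (cmod l)\<^sup>2)"
      using k kt by auto
    have "\<forall>l\<in>?E. \<exists>v. v \<noteq> 0 \<and> A *v v = l *s v" by (auto simp: eigenvalues_def)
    then obtain v where v: "\<And>l. l \<in> ?E \<Longrightarrow> v l \<noteq> 0" "\<And>l. l \<in> ?E \<Longrightarrow> A *v v l = l *s v l"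
      by metis
    define f where "f l = of_real (sqrt (t l) / norm (v l)) *s v l" for l
    define x where "x = (\<Sum>l\<in>?E. f l)"
    have f: "A *v f l = l *s f l" if "l \<in> ?E" for l
      using v(2) [OF that] by (simp add: f_def vector_scalar_commute vector_smult_assoc mult.commute)
    have "f l = (sqrt (t l) / norm (v l)) *\<^sub>R v l" for l
      by (simp add: f_def vec_eq_iff scaleR_conv_of_real [where 'a = complex])
    then have nf: "(norm (f l))\<^sup>2 = t l" if "l \<in> ?E" for l
      using v(1) [OF that] t(1) [OF that] by simp
    have q1: "hermitian_inner x (A *v x) = (\<Sum>l\<in>?E. t l *\<^sub>R l)" by (subst quot(1) [OF _ x_def]) (simp_all add: f nf)
    have q2: "(norm x)\<^sup>2 = 1" by (subst quot(2) [OF _ x_def]) (simp_all add: f nf t(2))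
    have q3: "(norm (A *v x))\<^sup>2 = (\<Sum>l\<in>?E. t l * (cmod l)\<^sup>2)" by (subst quot(3) [OF _ x_def]) (simp_all add: f nf)
    have "norm x = 1" using q2 by (simp add: power2_eq_1_iff) (metis norm_ge_zero not_one_le_zero neg_0_le_iff_le)
    moreover have "norm (A *v x) = sqrt (\<Sum>l\<in>?E. t l * (cmod l)\<^sup>2)"
      by (simp add: q3 [symmetric])
    moreover have "A *v x \<noteq> 0" using q3 h by auto
    ultimately show "w \<in> norm_num_range A"
      unfolding nnr w ratio_def mem_Collect_eq
      by (intro exI [of _ x]) (simp add: q1 scaleR_conv_of_real divide_inverse mult.commute)
  qed
qed

lemma snd_hull_lift_nonneg:
  assumes "k \<in> convex hull (lift ` S)"
  shows "snd k \<ge> 0"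
proof -
  have "lift ` S \<subseteq> snd -` {0..}" by (auto simp: lift_def)
  then have "convex hull (lift ` S) \<subseteq> snd -` {0..}"
    by (rule hull_minimal) (intro convex_linear_vimage linear_snd convex_real_interval)
  then show ?thesis using assms by auto
qed

lemma snd_hull_lift_pos:
  assumes "k \<in> convex hull (lift ` S)" "0 \<notin> S"
  shows "snd k > 0"
proof -
  have "lift ` S \<subseteq> snd -` {0<..}" using assms(2) by (auto simp: lift_def)
  then have "convex hull (lift ` S) \<subseteq> snd -` {0<..}"
    by (rule hull_minimal) (intro convex_linear_vimage linear_snd convex_real_interval)
  then show ?thesis using assms(1) by auto
qed

lemma continuous_on_ratio: "continuous_on {k. snd k > 0} ratio"
  unfolding ratio_def by (auto intro!: continuous_intros)

lemma spectral_range_mono: "S \<subseteq> T \<Longrightarrow> spectral_range S \<subseteq> spectral_range T"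
  using hull_mono [of "lift ` S" "lift ` T" convex] by (auto simp: spectral_range_def)

lemma ratioI_spectral_range:
  "k \<in> convex hull (lift ` S) \<Longrightarrow> snd k > 0 \<Longrightarrow> ratio k \<in> spectral_range S"
  by (auto simp: spectral_range_def)

lemma arc_param_eq_ratio: "arc_param a b t = ratio (t *\<^sub>R lift a + (1 - t) *\<^sub>R lift b)"
  by (simp add: arc_param_def ratio_def lift_def scaleR_conv_of_real divide_inverse mult.commute)

lemma arc_dom_iff: "t \<in> arc_dom a b \<longleftrightarrow> t \<in> {0..1} \<and> snd (t *\<^sub>R lift a + (1 - t) *\<^sub>R lift b) > 0"
proof -
  have "t * (cmod a)\<^sup>2 + (1 - t) * (cmod b)\<^sup>2 \<ge> 0" if "0 \<le> t" "t \<le> 1"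
    using that by simp
  then show ?thesis by (force simp: arc_dom_def lift_def less_le)
qed

lemma hyp_arc_eq_spectral_range: "hyp_arc a b = spectral_range {a, b}"
proof -
  have "convex hull (lift ` {a, b}) = (\<lambda>t. t *\<^sub>R lift a + (1 - t) *\<^sub>R lift b) ` {0..1}"
    by (force simp: convex_hull_2 image_iff)
  then show ?thesis
    unfolding hyp_arc_eq_image spectral_range_def arc_param_eq_ratio
    by (auto simp del: snd_add snd_scaleR simp add: arc_dom_iff)
qed

lemma unit_in_spectral_range:
  assumes "a \<in> S" "a \<noteq> 0"
  shows "a /\<^sub>R cmod a \<in> spectral_range S"
  using ratioI_spectral_range [of "lift a" S] assms hull_inc [of "lift a" "lift ` S" convex]
  by (simp add: ratio_def lift_def)

section \<open>Compactness and radial structure\<close>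

lemma compact_spectral_range:
  assumes "finite S" "0 \<notin> S"
  shows "compact (spectral_range S)"
proof -
  have "{k \<in> convex hull (lift ` S). snd k > 0} = convex hull (lift ` S)"
    using snd_hull_lift_pos [OF _ assms(2)] by auto
  then show ?thesis
    unfolding spectral_range_def using assms snd_hull_lift_pos
    by (auto intro!: compact_continuous_image continuous_on_subset [OF continuous_on_ratio]
        finite_imp_compact_convex_hull)
qed

lemma ratio_scale: "r > 0 \<Longrightarrow> ratio (r\<^sup>2 *\<^sub>R k) = r *\<^sub>R ratio k"
  by (simp add: ratio_def real_sqrt_mult power2_eq_square)

text \<open>Mixing with the lift \<open>(0, 0)\<close> of zero scales \<open>(z, h)\<close> to \<open>(v z, v h)\<close>, and the quotient
  \<open>z / sqrt h\<close> by \<open>sqrt v\<close>.\<close>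

lemma spectral_range_insert_zero:
  assumes "S \<noteq> {}"
  shows "w \<in> spectral_range (insert 0 S) \<longleftrightarrow> (\<exists>r\<in>{0<..1}. \<exists>w'\<in>spectral_range S. w = r *\<^sub>R w')"
proof
  assume "w \<in> spectral_range (insert 0 S)"
  then obtain k where k: "k \<in> convex hull (insert (lift 0) (lift ` S))" "snd k > 0" "w = ratio k"
    by (auto simp: spectral_range_def)
  then obtain u v b where uv: "u \<ge> 0" "v \<ge> 0" "u + v = 1" and b: "b \<in> convex hull (lift ` S)"
    and "k = u *\<^sub>R lift 0 + v *\<^sub>R b"
    using assms by (force simp: convex_hull_insert)
  then have kb: "k = v *\<^sub>R b" by (simp add: lift_def zero_prod_def [symmetric])
  have v: "v > 0" "snd b > 0"
    using k(2) uv(2) snd_hull_lift_nonneg [OF b] by (auto simp: kb zero_less_mult_iff)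
  then have "w = sqrt v *\<^sub>R ratio b"
    using ratio_scale [of "sqrt v" b] k(3) by (simp add: kb)
  then show "\<exists>r\<in>{0<..1}. \<exists>w'\<in>spectral_range S. w = r *\<^sub>R w'"
    using v uv ratioI_spectral_range [OF b] by (intro bexI [of _ "sqrt v"]) auto
next
  assume "\<exists>r\<in>{0<..1}. \<exists>w'\<in>spectral_range S. w = r *\<^sub>R w'"
  then obtain r k where r: "0 < r" "r \<le> 1" and k: "k \<in> convex hull (lift ` S)" "snd k > 0"
    and w: "w = ratio (r\<^sup>2 *\<^sub>R k)"
    by (auto simp: spectral_range_def ratio_scale)
  have "k \<in> convex hull (lift ` insert 0 S)"
    using k(1) hull_mono [of "lift ` S" "lift ` insert 0 S" convex] by auto
  moreover have "lift 0 \<in> convex hull (lift ` insert 0 S)" by (simp add: hull_inc)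
  ultimately have "(1 - r\<^sup>2) *\<^sub>R lift 0 + r\<^sup>2 *\<^sub>R k \<in> convex hull (lift ` insert 0 S)"
    using r by (intro convexD_alt [OF convex_convex_hull]) (auto simp: power_le_one)
  then have "r\<^sup>2 *\<^sub>R k \<in> convex hull (lift ` insert 0 S)"
    by (simp add: lift_def zero_prod_def [symmetric])
  then show "w \<in> spectral_range (insert 0 S)"
    unfolding w using r k by (intro ratioI_spectral_range) auto
qed

lemma spectral_range_scale:
  assumes "0 \<in> S" "w \<in> spectral_range S" "0 < r" "r \<le> 1"
  shows "r *\<^sub>R w \<in> spectral_range S"
  using spectral_range_insert_zero [of S "r *\<^sub>R w"] assms by (force simp: insert_absorb)

lemma spectral_range_zero: "spectral_range {0} = {}"
  by (auto simp: spectral_range_def lift_def)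

lemma compact_insert_zero_spectral_range:
  assumes "finite S"
  shows "compact (insert 0 (spectral_range S))"
proof (cases "0 \<in> S")
  case False
  then show ?thesis using compact_spectral_range assms by simp
next
  case True
  define T where "T = S - {0}"
  have S: "S = insert 0 T" using True by (auto simp: T_def)
  show ?thesis
  proof (cases "T = {}")
    case True
    then show ?thesis by (simp add: S spectral_range_zero)
  next
    case False
    then obtain v where v: "v \<in> spectral_range T"
      using unit_in_spectral_range [of _ T] by (auto simp: T_def)
    have "insert 0 (spectral_range S) = (\<lambda>(r, w). r *\<^sub>R w) ` ({0..1} \<times> spectral_range T)"
    proof (intro equalityI subsetI)
      fix w assume "w \<in> insert 0 (spectral_range S)"
      then consider "w = 0" | "w \<in> spectral_range S" by auto
      then show "w \<in> (\<lambda>(r, w). r *\<^sub>R w) ` ({0..1} \<times> spectral_range T)"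
      proof cases
        case 1
        then show ?thesis using v by (intro image_eqI [of _ _ "(0, v)"]) auto
      next
        case 2
        then obtain r w' where "r \<in> {0<..1}" "w' \<in> spectral_range T" "w = r *\<^sub>R w'"
          using spectral_range_insert_zero [OF False] by (auto simp: S)
        then show ?thesis by (intro image_eqI [of _ _ "(r, w')"]) auto
      qed
    next
      fix w assume "w \<in> (\<lambda>(r, w). r *\<^sub>R w) ` ({0..1} \<times> spectral_range T)"
      then obtain r w' where r: "0 \<le> r" "r \<le> 1" "w' \<in> spectral_range T" "w = r *\<^sub>R w'" by auto
      then show "w \<in> insert 0 (spectral_range S)"
        using spectral_range_insert_zero [OF False, of w] by (cases "r = 0") (auto simp: S)
    qed
    moreover have "compact ({0..1::real} \<times> spectral_range T)"
      using assms by (intro compact_Times compact_spectral_range) (auto simp: T_def)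
    ultimately show ?thesis
      by (auto intro!: compact_continuous_image continuous_intros simp: case_prod_unfold)
  qed
qed

text \<open>The weight on the eigenvalue zero contributes neither to \<open>z\<close> nor to \<open>h\<close>, so it can be removed
  by renormalizing the others.\<close>

lemma zero_in_spectral_range_iff:
  assumes "finite S"
  shows "0 \<in> spectral_range S \<longleftrightarrow> 0 \<in> convex hull (S - {0})"
proof
  assume "0 \<in> spectral_range S"
  then obtain k where k: "k \<in> convex hull (lift ` S)" "snd k > 0" "0 = ratio k"
    unfolding spectral_range_def by blast
  then obtain t where t: "\<And>l. l \<in> S \<Longrightarrow> 0 \<le> t l" "sum t S = 1"
    and kt: "k = (\<Sum>l\<in>S. t l *\<^sub>R l, \<Sum>l\<in>S. t l * (cmod l)\<^sup>2)"
    unfolding convex_hull_lift [OF assms] by blast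
  have z: "(\<Sum>l\<in>S. t l *\<^sub>R l) = 0" and h: "(\<Sum>l\<in>S. t l * (cmod l)\<^sup>2) > 0"
    using k(2,3) unfolding kt ratio_def by (simp_all del: scaleR_sum_right)
  from h obtain l where l: "l \<in> S" "t l * (cmod l)\<^sup>2 \<noteq> 0"
    using sum.not_neutral_contains_not_neutral [of "\<lambda>l. t l * (cmod l)\<^sup>2" S] by auto
  then have l': "l \<in> S - {0}" "t l > 0" using t(1) [of l] by auto
  define s where "s = sum t (S - {0})"
  have s: "s > 0" unfolding s_def using assms t l' by (intro sum_pos2) auto
  have "(\<Sum>l\<in>S. t l *\<^sub>R l) = (\<Sum>l\<in>S - {0}. t l *\<^sub>R l)"
    by (rule sum.mono_neutral_right) (use assms in auto)
  moreover have "(\<Sum>l\<in>S - {0}. (t l / s) *\<^sub>R l) = (1 / s) *\<^sub>R (\<Sum>l\<in>S - {0}. t l *\<^sub>R l)"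
    by (simp add: scaleR_sum_right)
  ultimately have "(\<Sum>l\<in>S - {0}. (t l / s) *\<^sub>R l) = 0"
    using z by simp
  moreover have "(\<Sum>l\<in>S - {0}. t l / s) = 1"
    using s by (simp add: sum_divide_distrib [symmetric] s_def)
  ultimately show "0 \<in> convex hull (S - {0})"
    unfolding convex_hull_finite [OF finite_Diff [OF assms]] mem_Collect_eq
    using s t(1) by (intro exI [of _ "\<lambda>l. t l / s"]) simp
next
  assume "0 \<in> convex hull (S - {0})"
  then obtain t where t: "\<And>l. l \<in> S - {0} \<Longrightarrow> 0 \<le> t l" "sum t (S - {0}) = 1"
    "(\<Sum>l\<in>S - {0}. t l *\<^sub>R l) = 0"
    unfolding convex_hull_finite [OF finite_Diff [OF assms]] by blast
  define k where "k = (\<Sum>l\<in>S - {0}. t l *\<^sub>R l, \<Sum>l\<in>S - {0}. t l * (cmod l)\<^sup>2)"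
  have k: "k \<in> convex hull (lift ` (S - {0}))"
    unfolding k_def convex_hull_lift [OF finite_Diff [OF assms]] using t by blast
  then have "snd k > 0" by (rule snd_hull_lift_pos) auto
  with k have "ratio k \<in> spectral_range (S - {0})" by (rule ratioI_spectral_range)
  moreover have "ratio k = 0" by (simp add: ratio_def k_def t)
  ultimately show "0 \<in> spectral_range S" using spectral_range_mono [of "S - {0}" S] by auto
qed

lemma inner_pos_spectral_range:
  assumes "finite S" and u: "\<And>l. l \<in> S - {0} \<Longrightarrow> inner u l > 0" and "w \<in> spectral_range S"
  shows "inner u w > 0"
proof -
  from assms(3) obtain k where k: "k \<in> convex hull (lift ` S)" "snd k > 0" "w = ratio k"
    by (auto simp: spectral_range_def)
  then obtain t where t: "\<And>l. l \<in> S \<Longrightarrow> 0 \<le> t l"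
    and kt: "k = (\<Sum>l\<in>S. t l *\<^sub>R l, \<Sum>l\<in>S. t l * (cmod l)\<^sup>2)"
    unfolding convex_hull_lift [OF assms(1)] by blast
  have h: "(\<Sum>l\<in>S. t l * (cmod l)\<^sup>2) > 0"
    and w: "w = ratio (\<Sum>l\<in>S. t l *\<^sub>R l, \<Sum>l\<in>S. t l * (cmod l)\<^sup>2)"
    using k kt by auto
  from h obtain l where l: "l \<in> S" "t l * (cmod l)\<^sup>2 \<noteq> 0"
    using sum.not_neutral_contains_not_neutral [of "\<lambda>l. t l * (cmod l)\<^sup>2" S] by auto
  then have l': "l \<in> S" "t l * inner u l > 0" using t [of l] u [of l] by auto
  have "t l * inner u l \<ge> 0" if "l \<in> S" for l
    using t [OF that] u [of l] that by (cases "l = 0") auto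
  then have "(\<Sum>l\<in>S. t l * inner u l) > 0" using assms(1) l' by (intro sum_pos2) auto
  then show ?thesis using h by (simp add: w ratio_def inner_sum_right)
qed

text \<open>The points of \<open>K\<close> above a ray from the origin form a convex set; along the segment between
  two of them the quotient moves continuously on the ray.\<close>

lemma spectral_range_radial_interval:
  assumes "r1 *\<^sub>R w \<in> spectral_range S" "r2 *\<^sub>R w \<in> spectral_range S" "r1 \<le> 1" "1 \<le> r2"
  shows "w \<in> spectral_range S"
proof -
  obtain k1 where k1: "k1 \<in> convex hull (lift ` S)" "snd k1 > 0" "ratio k1 = r1 *\<^sub>R w"
    using assms(1) by (auto simp: spectral_range_def)
  obtain k2 where k2: "k2 \<in> convex hull (lift ` S)" "snd k2 > 0" "ratio k2 = r2 *\<^sub>R w"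
    using assms(2) by (auto simp: spectral_range_def)
  have f1: "fst k1 = (r1 * sqrt (snd k1)) *\<^sub>R w"
    using arg_cong [OF k1(3), of "\<lambda>z. sqrt (snd k1) *\<^sub>R z"] k1(2) by (simp add: ratio_def mult.commute)
  have f2: "fst k2 = (r2 * sqrt (snd k2)) *\<^sub>R w"
    using arg_cong [OF k2(3), of "\<lambda>z. sqrt (snd k2) *\<^sub>R z"] k2(2) by (simp add: ratio_def mult.commute)
  define c where "c t = (1 - t) * (r1 * sqrt (snd k1)) + t * (r2 * sqrt (snd k2))" for t
  define h where "h t = (1 - t) * snd k1 + t * snd k2" for t
  have "continuous_on {0..1} (\<lambda>t. c t - sqrt (h t))"
    unfolding c_def h_def by (intro continuous_intros)
  moreover have "c 0 - sqrt (h 0) \<le> 0" "c 1 - sqrt (h 1) \<ge> 0"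
    using assms k1 k2 by (simp_all add: c_def h_def)
  ultimately obtain t where t: "0 \<le> t" "t \<le> 1" "c t - sqrt (h t) = 0"
    using IVT' [of "\<lambda>t. c t - sqrt (h t)" 0 0 1] by auto
  define k where "k = (1 - t) *\<^sub>R k1 + t *\<^sub>R k2"
  have kh: "k \<in> convex hull (lift ` S)"
    unfolding k_def by (rule convexD_alt [OF convex_convex_hull k1(1) k2(1) t(1,2)])
  have sk: "snd k = h t" by (simp add: k_def h_def)
  have pos: "snd k > 0"
    using t k1(2) k2(2) unfolding sk h_def
    by (cases "t = 0") (auto intro!: add_nonneg_pos)
  have "fst k = c t *\<^sub>R w"
    by (simp add: k_def f1 f2 c_def algebra_simps)
  then have "ratio k = w" using t(3) pos sk by (simp add: ratio_def)
  then show ?thesis using ratioI_spectral_range [OF kh pos] by simp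
qed

lemma connected_unbounded_not_inside:
  assumes "connected Z" "\<not> bounded Z" "w \<in> Z" "Z \<inter> E = {}"
  shows "w \<notin> inside E"
  using connected_component_maximal [of w Z "- E"] assms bounded_subset
  by (auto simp: inside_def)

lemma unbounded_ray:
  fixes u :: "'a::real_normed_vector"
  assumes "u \<noteq> 0"
  shows "\<not> bounded ((\<lambda>r. r *\<^sub>R u) ` {a..})"
proof
  assume "bounded ((\<lambda>r. r *\<^sub>R u) ` {a..})"
  then obtain B where B: "\<And>r. r \<ge> a \<Longrightarrow> norm (r *\<^sub>R u) \<le> B" by (auto simp: bounded_iff)
  define r where "r = max \<bar>a\<bar> ((\<bar>B\<bar> + 1) / norm u)"
  have "(\<bar>B\<bar> + 1) / norm u \<le> r" by (simp add: r_def)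
  then have "\<bar>B\<bar> + 1 \<le> r * norm u" using assms by (simp add: pos_divide_le_eq)
  moreover have "r \<ge> 0" "r \<ge> a" by (auto simp: r_def)
  ultimately show False using B [of r] by simp
qed

lemma connected_ray: "connected ((\<lambda>r. r *\<^sub>R u) ` ({a..} :: real set))"
  for u :: "'a::real_normed_vector"
  by (intro connected_continuous_image continuous_intros convex_connected convex_real_interval)

text \<open>A point outside of the range must be joined to infinity. If the range does not meet the outer
  part of its ray, that part will do. Otherwise the origin is missing from the range, which therefore
  lies in an open half plane, and the point can move inward to the origin and then away from the
  half plane. A point other than the origin takes this second route only if zero is not an
  eigenvalue, and then \<open>E\<close> does not contain the origin, where the route passes.\<close>

lemma inside_subset_spectral_range:
  assumes fin: "finite S" and E: "E \<subseteq> insert 0 (spectral_range S)"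
    and E0: "0 \<notin> S \<Longrightarrow> E \<subseteq> spectral_range S"
  shows "inside E \<subseteq> spectral_range S"
proof
  fix w assume w: "w \<in> inside E"
  have wE: "w \<notin> E" using w by (simp add: inside_def)
  show "w \<in> spectral_range S"
  proof (rule ccontr)
    assume nw: "w \<notin> spectral_range S"
    show False
    proof (cases "w \<noteq> 0 \<and> (\<forall>r\<ge>1. r *\<^sub>R w \<notin> spectral_range S)")
      case True
      then have "(\<lambda>r. r *\<^sub>R w) ` {1..} \<inter> E = {}" using E by force
      moreover have "\<not> bounded ((\<lambda>r. r *\<^sub>R w) ` {1..})" using True by (intro unbounded_ray) simp
      moreover have "w \<in> (\<lambda>r. r *\<^sub>R w) ` {1..}" by (auto intro!: image_eqI [of _ _ 1])
      ultimately show False using w connected_unbounded_not_inside [OF connected_ray] by blast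
    next
      case False
      have "0 \<notin> spectral_range S"
      proof
        assume 0: "0 \<in> spectral_range S"
        then have "w \<noteq> 0" using nw by auto
        then obtain r where "r \<ge> 1" "r *\<^sub>R w \<in> spectral_range S" using False by auto
        then show False using spectral_range_radial_interval [of 0 w S r] 0 nw by simp
      qed
      then have "0 \<notin> convex hull (S - {0})" using zero_in_spectral_range_iff fin by blast
      then obtain u where u: "u \<noteq> 0" "\<And>l. l \<in> S - {0} \<Longrightarrow> inner u l > 0"
      proof -
        have "closed (convex hull (S - {0}))"
          using fin by (simp add: compact_imp_closed finite_imp_compact_convex_hull)
        then obtain a b where "a \<noteq> 0" "0 < b" "\<And>x. x \<in> convex hull (S - {0}) \<Longrightarrow> inner a x > b"
          using separating_hyperplane_closed_0 [OF convex_convex_hull] \<open>0 \<notin> convex hull (S - {0})\<close> by metis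
        then show thesis
          using that [of a] hull_inc [of _ "S - {0}" convex] by (meson order_less_trans)
      qed
      let ?R = "(\<lambda>r. r *\<^sub>R (- u)) ` {0..}"
      have R: "?R \<inter> spectral_range S = {}"
      proof -
        have "r *\<^sub>R (- u) \<notin> spectral_range S" if "r \<ge> 0" for r
        proof
          assume "r *\<^sub>R (- u) \<in> spectral_range S"
          then have "inner u (r *\<^sub>R (- u)) > 0"
            by (rule inner_pos_spectral_range [OF fin u(2), rotated])
          then show False using that mult_nonneg_nonneg [OF that inner_ge_zero, of u] by simp
        qed
        then show ?thesis by blast
      qed
      have nbR: "\<not> bounded ?R" using u by (intro unbounded_ray) auto
      show False
      proof (cases "w = 0")
        case True
        have "E \<subseteq> spectral_range S" using E wE unfolding True by auto
        then have "?R \<inter> E = {}" using R Int_mono [OF order_refl [of ?R]] by (metis subset_empty)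
        moreover have "w \<in> ?R" using True by (auto intro!: image_eqI [of _ _ 0])
        ultimately show False using w connected_unbounded_not_inside [OF connected_ray nbR] by simp
      next
        case w0: False
        then obtain r where r: "r \<ge> 1" "r *\<^sub>R w \<in> spectral_range S" using False by auto
        have "0 \<notin> S"
          using spectral_range_scale [of S "r *\<^sub>R w" "1 / r"] r nw by auto
        then have ES: "E \<subseteq> spectral_range S" by (rule E0)
        let ?I = "(\<lambda>s. s *\<^sub>R w) ` {0..1::real}"
        have "t *\<^sub>R w \<notin> spectral_range S" if "t \<le> 1" for t
          using spectral_range_radial_interval [of t w S r] that r nw by blast
        then have "?I \<inter> spectral_range S = {}" by auto
        moreover have "connected ?I"
          by (intro connected_continuous_image continuous_intros convex_connected convex_real_interval)
        moreover have "0 \<in> ?I \<inter> ?R" by (auto intro!: image_eqI [of _ _ 0])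
        ultimately have "connected (?I \<union> ?R)" and "(?I \<union> ?R) \<inter> spectral_range S = {}"
          using connected_Un [OF _ connected_ray [of "- u" 0], of ?I] R by (simp_all add: Int_Un_distrib2, blast)
        then have "connected (?I \<union> ?R)" and "(?I \<union> ?R) \<inter> E = {}" using ES by auto
        moreover have "\<not> bounded (?I \<union> ?R)" using nbR by simp
        moreover have "w \<in> ?I \<union> ?R" by (auto intro!: image_eqI [of _ _ 1])
        ultimately show False using w connected_unbounded_not_inside [of "?I \<union> ?R" w E] by simp
      qed
    qed
  qed
qed

section \<open>Segments on bitangent lines lie in the range\<close>

text \<open>To place a bitangent segment in the range it suffices to join its ends inside the range by any
  path that stays on the line.\<close>

lemma closed_segment_subset_connected_in_line:
  fixes L :: "complex set"
  assumes "aff_dim L = 1" "Z \<subseteq> L" "connected Z" "p \<in> Z" "q \<in> Z"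
  shows "closed_segment p q \<subseteq> Z"
proof -
  have "collinear Z"
    using aff_dim_subset [OF assms(2)] assms(1) by (simp add: collinear_aff_dim)
  then show ?thesis using assms by (simp add: convex_connected_collinear closed_segment_subset)
qed

lemma line_eq_hyperplane:
  fixes L :: "complex set"
  assumes "affine L" "aff_dim L = 1"
  obtains n d where "n \<noteq> 0" "L = {w. inner n w = d}"
proof -
  have "aff_dim L = DIM(complex) - 1" using assms(2) by simp
  then show thesis using that assms(1) unfolding aff_dim_eq_hyperplane by (auto simp: hull_same)
qed

text \<open>This makes derivatives within the parameter interval unique, also at its end points.\<close>

lemma at_within_arc_dom:
  assumes "a \<noteq> b" "t \<in> arc_dom a b"
  shows "at t within arc_dom a b \<noteq> bot"
proof -
  have "arc_dom a b = {0..1} \<inter> {t. inner ((cmod b)\<^sup>2 - (cmod a)\<^sup>2) t < (cmod b)\<^sup>2}"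
    by (auto simp: arc_dom_iff lift_def algebra_simps)
  then have "convex (arc_dom a b)"
    by (simp only:) (intro convex_Int convex_real_interval convex_halfspace_lt)
  then have "connected (arc_dom a b)" by (rule convex_connected)
  moreover have "1/2 \<in> arc_dom a b" "1/4 \<in> arc_dom a b"
    using assms(1) by (auto simp: arc_dom_def add_nonneg_eq_0_iff)
  then have "arc_dom a b \<noteq> {x}" for x by force
  ultimately have "t islimpt arc_dom a b" using assms(2) by (intro connected_imp_perfect)
  then show ?thesis by (simp add: trivial_limit_within)
qed

text \<open>Above the line \<open>inner n w = d\<close> lies the parabolic cylinder \<open>inner n z = d sqrt h\<close>. Along the
  edge, \<open>inner n z\<close> and \<open>h\<close> are affine in the parameter, and tangency says that the two sides agree to
  first order at the point \<open>k\<close> of height \<open>s\<^sup>2\<close>. Hence \<open>inner n z\<close> equals the linearization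
  \<open>d (h + s\<^sup>2) / (2 s)\<close> of \<open>d sqrt h\<close> on the whole edge, in particular at the two vertices.\<close>

lemma tangent_line_at_imp_edge_equations:
  assumes "tangent_line_at {w. inner n w = d} a b p" "a \<noteq> b"
  obtains k s where "k \<in> convex hull {lift a, lift b}" "s > 0" "snd k = s\<^sup>2" "fst k = s *\<^sub>R p"
    "inner n p = d" "p = ratio k"
    "2 * s * inner n a = d * ((cmod a)\<^sup>2 + s\<^sup>2)" "2 * s * inner n b = d * ((cmod b)\<^sup>2 + s\<^sup>2)"
proof -
  let ?D = "arc_dom a b"
  obtain t v where t: "t \<in> ?D" and p: "p = arc_param a b t"
    and der: "(arc_param a b has_vector_derivative v) (at t within ?D)"
    and np: "inner n p = d" and nv: "inner n v = 0"
    using assms(1) by (auto simp: tangent_line_at_def inner_add_right)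
  define h where "h \<tau> = \<tau> * (cmod a)\<^sup>2 + (1 - \<tau>) * (cmod b)\<^sup>2" for \<tau>
  define X where "X \<tau> = \<tau> * inner n a + (1 - \<tau>) * inner n b" for \<tau>
  define \<phi> where "\<phi> \<tau> = inner n (arc_param a b \<tau>)" for \<tau>
  define s where "s = sqrt (h t)"
  define h' where "h' = (cmod a)\<^sup>2 - (cmod b)\<^sup>2"
  have hpos: "h \<tau> > 0" if "\<tau> \<in> ?D" for \<tau>
    using that by (simp add: arc_dom_iff h_def lift_def)
  have s: "s > 0" "s\<^sup>2 = h t" using hpos [OF t] by (simp_all add: s_def)
  have Xeq: "X \<tau> = \<phi> \<tau> * sqrt (h \<tau>)" if "\<tau> \<in> ?D" for \<tau>
    using hpos [OF that]
    by (simp add: \<phi>_def X_def arc_param_eq_ratio ratio_def lift_def h_def inner_add_right)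
  have d\<phi>: "(\<phi> has_field_derivative 0) (at t within ?D)"
    using bounded_linear.has_vector_derivative [OF bounded_linear_inner_right der, of n]
    by (simp add: \<phi>_def [abs_def] nv has_real_derivative_iff_has_vector_derivative)
  have dh: "((\<lambda>\<tau>. sqrt (h \<tau>)) has_field_derivative h' / (2 * s)) (at t within ?D)"
    unfolding h_def using hpos [OF t] s
    by (auto intro!: derivative_eq_intros simp: h_def s_def h'_def field_simps)
  have "\<phi> t = d" using np p by (simp add: \<phi>_def)
  then have "((\<lambda>\<tau>. \<phi> \<tau> * sqrt (h \<tau>)) has_field_derivative d * h' / (2 * s)) (at t within ?D)"
    using DERIV_mult [OF d\<phi> dh] by (simp add: mult.commute)
  then have "(X has_field_derivative d * h' / (2 * s)) (at t within ?D)"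
    by (rule has_field_derivative_transform_within [of _ _ _ _ 1]) (use t Xeq in auto)
  moreover have "(X has_field_derivative inner n a - inner n b) (at t within ?D)"
    unfolding X_def by (auto intro!: derivative_eq_intros)
  ultimately have "inner n a - inner n b = d * h' / (2 * s)"
    using vector_derivative_unique_within [OF at_within_arc_dom [OF assms(2) t]]
    by (simp add: has_real_derivative_iff_has_vector_derivative) blast
  then have X': "2 * s * (inner n a - inner n b) = d * h'" using s by simp
  have "X t = d * s" using Xeq [OF t] \<open>\<phi> t = d\<close> s_def by simp
  then have Xt: "2 * s * X t = 2 * d * h t" using s(2) by (simp add: power2_eq_square)
  have ht: "h t = t * h' + (cmod b)\<^sup>2" by (simp add: h_def h'_def algebra_simps)
  have "2 * s * X t = t * (2 * s * (inner n a - inner n b)) + 2 * s * inner n b"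
    by (simp add: X_def algebra_simps)
  then have b: "2 * s * inner n b = 2 * d * h t - t * (d * h')" using Xt X' by simp
  also have "\<dots> = d * ((cmod b)\<^sup>2 + h t)" by (simp add: ht algebra_simps)
  finally have b': "2 * s * inner n b = d * ((cmod b)\<^sup>2 + s\<^sup>2)" by (simp add: s)
  have "2 * s * inner n a = 2 * s * inner n b + d * h'" using X' by (simp add: algebra_simps)
  then have a': "2 * s * inner n a = d * ((cmod a)\<^sup>2 + s\<^sup>2)" using b' by (simp add: h'_def algebra_simps)
  define k where "k = t *\<^sub>R lift a + (1 - t) *\<^sub>R lift b"
  have "k \<in> convex hull {lift a, lift b}"
    using t unfolding convex_hull_2 k_def by (force simp: arc_dom_def)
  moreover have "snd k = s\<^sup>2" by (simp add: k_def s h_def lift_def)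
  moreover have "p = ratio k" by (simp add: p arc_param_eq_ratio k_def)
  moreover then have "fst k = s *\<^sub>R p" using s(1) by (simp add: ratio_def \<open>snd k = s\<^sup>2\<close>)
  ultimately show thesis using that s np a' b' by blast
qed

text \<open>Let the tangency points have heights \<open>s\<^sup>2\<close> and \<open>r\<^sup>2\<close>. Both edge equations hold at the shared
  vertex \<open>b\<close>, which leaves three possibilities. If \<open>d = 0\<close>, the whole triangle lies above the line. If
  \<open>s = r\<close>, the segment between the two tangency points is horizontal and maps to the line. Otherwise
  \<open>s r = |b|\<^sup>2\<close>; then the lift of \<open>b\<close> is where the tangents of the parabola \<open>inner n z = d sqrt h\<close> at
  the two points meet, and the quadratic Bezier curve with these three control points, which stays in
  their convex hull, runs on the parabola.\<close>

lemma bitangent_segment_subset: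
  assumes L: "tangent_line_at L a b p" "tangent_line_at L b c q" and ab: "a \<noteq> b" "b \<noteq> c"
  shows "closed_segment p q \<subseteq> spectral_range {a, b, c}"
proof -
  have aff: "affine L" "aff_dim L = 1" using L(1) by (auto simp: tangent_line_at_def)
  then obtain n d where "n \<noteq> 0" and Leq: "L = {w. inner n w = d}" by (rule line_eq_hyperplane)
  obtain k s where k: "k \<in> convex hull {lift a, lift b}" "snd k = s\<^sup>2" "fst k = s *\<^sub>R p" "p = ratio k"
    and s: "s > 0" and p: "inner n p = d"
    and ea: "2 * s * inner n a = d * ((cmod a)\<^sup>2 + s\<^sup>2)" and eb: "2 * s * inner n b = d * ((cmod b)\<^sup>2 + s\<^sup>2)"
    using tangent_line_at_imp_edge_equations [OF L(1) [unfolded Leq] ab(1)] by metis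
  obtain k' r where k': "k' \<in> convex hull {lift b, lift c}" "snd k' = r\<^sup>2" "fst k' = r *\<^sub>R q" "q = ratio k'"
    and r: "r > 0" and q: "inner n q = d"
    and eb': "2 * r * inner n b = d * ((cmod b)\<^sup>2 + r\<^sup>2)" and ec: "2 * r * inner n c = d * ((cmod c)\<^sup>2 + r\<^sup>2)"
    using tangent_line_at_imp_edge_equations [OF L(2) [unfolded Leq] ab(2)] by metis
  let ?T = "convex hull (lift ` {a, b, c})"
  have kT: "k \<in> ?T" "k' \<in> ?T"
    using k(1) k'(1) hull_mono [of "{lift a, lift b}" "lift ` {a, b, c}" convex]
      hull_mono [of "{lift b, lift c}" "lift ` {a, b, c}" convex] by auto
  have main: "closed_segment p q \<subseteq> spectral_range {a, b, c}"
    if Z: "connected Z" "k \<in> Z" "k' \<in> Z" "Z \<subseteq> ?T" "\<And>x. x \<in> Z \<Longrightarrow> snd x > 0"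
      "\<And>x. x \<in> Z \<Longrightarrow> inner n (ratio x) = d" for Z
  proof -
    have "connected (ratio ` Z)"
      using Z by (intro connected_continuous_image continuous_on_subset [OF continuous_on_ratio]) auto
    then have "closed_segment p q \<subseteq> ratio ` Z"
      using Z k k' by (intro closed_segment_subset_connected_in_line [OF aff(2)]) (auto simp: Leq)
    then show ?thesis using Z by (force simp: spectral_range_def)
  qed
  have hyp: "inner N x = \<beta>" if "\<And>y. y \<in> {a, b, c} \<Longrightarrow> inner N (lift y) = \<beta>" "x \<in> ?T" for N x \<beta>
  proof -
    have "?T \<subseteq> {x. inner N x = \<beta>}" using that(1) by (intro hull_minimal convex_hyperplane) auto
    then show ?thesis using that(2) by auto
  qed
  consider "d = 0" | "s = r" | "d \<noteq> 0" "s * r = (cmod b)\<^sup>2"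
  proof -
    have "r * (2 * s * inner n b) = s * (2 * r * inner n b)" by simp
    then have "d * (r * ((cmod b)\<^sup>2 + s\<^sup>2)) = d * (s * ((cmod b)\<^sup>2 + r\<^sup>2))" unfolding eb eb' by (simp add: mult_ac)
    moreover have "r * ((cmod b)\<^sup>2 + s\<^sup>2) - s * ((cmod b)\<^sup>2 + r\<^sup>2) = (s - r) * (s * r - (cmod b)\<^sup>2)"
      by (simp add: power2_eq_square algebra_simps)
    ultimately have "d = 0 \<or> (s - r) * (s * r - (cmod b)\<^sup>2) = 0" by auto
    then show thesis using that by auto
  qed
  then show ?thesis
  proof cases
    case 1
    have "{x \<in> ?T. snd x > 0} = ?T \<inter> snd -` {0<..}" by auto
    then have "convex {x \<in> ?T. snd x > 0}"
      by (simp only:) (intro convex_Int convex_convex_hull convex_linear_vimage linear_snd convex_real_interval)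
    moreover have "inner n (fst x) = 0" if "x \<in> ?T" for x
      using hyp [of "(n, 0)" 0 x] that ea eb ec s r 1 by (auto simp: lift_def inner_prod_def)
    ultimately show ?thesis
      using kT k k' s r 1
      by (intro main [of "{x \<in> ?T. snd x > 0}"]) (auto simp: ratio_def convex_connected)
  next
    case 2
    have seg: "closed_segment k k' \<subseteq> ?T" using kT by (simp add: closed_segment_subset)
    have sn: "snd x = s\<^sup>2" if x: "x \<in> closed_segment k k'" for x
    proof -
      obtain u where "x = (1 - u) *\<^sub>R k + u *\<^sub>R k'" using x unfolding in_segment by blast
      then have "snd x = snd ((1 - u) *\<^sub>R k + u *\<^sub>R k')" by (rule arg_cong)
      also have "\<dots> = s\<^sup>2" using k(2) k'(2) 2 by (simp add: algebra_simps)
      finally show ?thesis .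
    qed
    have nx: "inner n (ratio x) = d" if x: "x \<in> closed_segment k k'" for x
    proof -
      have "inner ((2 * s) *\<^sub>R n, - d) x = d * s\<^sup>2"
        by (rule hyp) (use ea eb ec 2 x seg in \<open>auto simp: lift_def inner_prod_def algebra_simps\<close>)
      then have "2 * s * inner n (fst x) = 2 * d * s\<^sup>2" by (simp add: inner_prod_def sn x)
      then show ?thesis using s by (simp add: ratio_def sn x field_simps power2_eq_square)
    qed
    show ?thesis
      by (rule main [of "closed_segment k k'"]) (use seg sn nx s in auto)
  next
    case 3
    \<comment> \<open>The Bezier curve; its height is the square of \<open>\<sigma> \<tau>\<close> precisely because \<open>s * r = (cmod b)\<^sup>2\<close>.\<close>
    define K where "K \<tau> = (1 - \<tau>)\<^sup>2 *\<^sub>R k + (2 * \<tau> * (1 - \<tau>)) *\<^sub>R lift b + \<tau>\<^sup>2 *\<^sub>R k'" for \<tau>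
    define \<sigma> where "\<sigma> \<tau> = (1 - \<tau>) * s + \<tau> * r" for \<tau>
    have \<sigma>: "\<sigma> \<tau> > 0" if "0 \<le> \<tau>" "\<tau> \<le> 1" for \<tau>
      using that s r by (cases "\<tau> = 0") (auto simp: \<sigma>_def intro!: add_nonneg_pos)
    have KT: "K \<tau> \<in> ?T" if "0 \<le> \<tau>" "\<tau> \<le> 1" for \<tau>
    proof -
      have "(1 - \<tau>)\<^sup>2 + 2 * \<tau> * (1 - \<tau>) + \<tau>\<^sup>2 = 1" by (simp add: power2_eq_square algebra_simps)
      then have "K \<tau> \<in> convex hull {k, lift b, k'}"
        unfolding K_def convex_hull_3 using that
        by (intro CollectI exI [of _ "(1 - \<tau>)\<^sup>2"] exI [of _ "2 * \<tau> * (1 - \<tau>)"] exI [of _ "\<tau>\<^sup>2"]) auto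
      moreover have "convex hull {k, lift b, k'} \<subseteq> ?T"
        using kT by (intro hull_minimal) (auto intro: hull_inc)
      ultimately show ?thesis by auto
    qed
    have snK: "snd (K \<tau>) = (\<sigma> \<tau>)\<^sup>2" for \<tau>
      using k(2) k'(2) 3(2) by (simp add: K_def \<sigma>_def lift_def power2_eq_square algebra_simps)
    have "2 * s * inner n b = 2 * s * (d * (s + r) / 2)"
      using eb 3(2) by (simp add: power2_eq_square algebra_simps)
    then have nb: "inner n b = d * (s + r) / 2" using s by simp
    have fK: "inner n (fst (K \<tau>)) = d * \<sigma> \<tau>" for \<tau>
    proof -
      have "inner n (fst (K \<tau>)) = (1 - \<tau>)\<^sup>2 * (s * d) + 2 * \<tau> * (1 - \<tau>) * inner n b + \<tau>\<^sup>2 * (r * d)"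
        by (simp add: K_def lift_def inner_add_right k(3) k'(3) p q)
      then show ?thesis by (simp add: nb \<sigma>_def power2_eq_square field_simps)
    qed
    have "K 0 = k" "K 1 = k'" by (simp_all add: K_def)
    then have ends: "k \<in> K ` {0..1}" "k' \<in> K ` {0..1}"
      by (auto intro: image_eqI [of _ _ 0] image_eqI [of _ _ 1])
    have "connected (K ` {0..1})"
      unfolding K_def by (intro connected_continuous_image continuous_intros convex_connected convex_real_interval)
    moreover have "snd (K \<tau>) > 0" if "0 \<le> \<tau>" "\<tau> \<le> 1" for \<tau>
      using \<sigma> [OF that] by (simp add: snK)
    moreover have "inner n (ratio (K \<tau>)) = d" if "0 \<le> \<tau>" "\<tau> \<le> 1" for \<tau>
      using \<sigma> [OF that] by (simp add: ratio_def snK fK)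
    ultimately show ?thesis
      using KT by (intro main [OF _ ends]) auto
  qed
qed

section \<open>Points that are not interior lie on an arc or a bitangent segment\<close>

lemma ratio_parabola: "s > 0 \<Longrightarrow> ratio (s *\<^sub>R w, s\<^sup>2) = w"
  by (simp add: ratio_def)

text \<open>Every point of positive height lies on the parabola of its quotient, at parameter \<open>sqrt h\<close>.\<close>

lemma parabola_ratio:
  assumes "snd k > 0"
  shows "k = (sqrt (snd k) *\<^sub>R ratio k, (sqrt (snd k))\<^sup>2)"
  using assms by (simp add: ratio_def prod_eq_iff)

text \<open>Keeping the height fixed, a small change of \<open>w\<close> moves the contact point only a little, and it
  stays in the polytope.\<close>

lemma interior_spectral_range:
  assumes "k \<in> interior (convex hull (lift ` S))" "snd k > 0"
  shows "ratio k \<in> interior (spectral_range S)"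
proof -
  define s where "s = sqrt (snd k)"
  have s: "s > 0" and k: "k = (s *\<^sub>R ratio k, s\<^sup>2)"
    using assms(2) parabola_ratio [OF assms(2)] by (simp_all add: s_def)
  let ?f = "\<lambda>w. (s *\<^sub>R w, s\<^sup>2)"
  have "open (?f -` interior (convex hull (lift ` S)))"
    by (intro open_vimage open_interior continuous_intros)
  moreover have "ratio k \<in> ?f -` interior (convex hull (lift ` S))" using k assms(1) by simp
  moreover have "?f -` interior (convex hull (lift ` S)) \<subseteq> spectral_range S"
  proof
    fix w assume "w \<in> ?f -` interior (convex hull (lift ` S))"
    then have "?f w \<in> convex hull (lift ` S)" using interior_subset by auto
    then show "w \<in> spectral_range S"
      using ratioI_spectral_range [of "?f w" S] s ratio_parabola [OF s, of w] by simp
  qed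
  ultimately show ?thesis by (meson interiorI)
qed

text \<open>The plane equation along the parabola of \<open>w\<close> is a polynomial \<open>F w s\<close> in \<open>s\<close>, and the hypothesis
  says that its derivative at the contact point is nonzero. So \<open>F w0\<close> changes sign there, \<open>F w\<close>
  still does for \<open>w\<close> near \<open>w0\<close>, and the intermediate value theorem yields a contact point for \<open>w\<close>
  near \<open>k\<close>, which belongs to the polytope because \<open>k\<close> is in its relative interior.\<close>

lemma interior_spectral_range_transversal:
  assumes k: "k \<in> rel_interior (convex hull T)" and T: "T \<subseteq> lift ` S" and pos: "snd k > 0"
    and plane: "affine hull T = {x. inner (n, \<alpha>) x = \<beta>}"
    and transversal: "2 * \<alpha> * sqrt (snd k) + inner n (ratio k) \<noteq> 0"
  shows "ratio k \<in> interior (spectral_range S)"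
proof -
  define s0 where "s0 = sqrt (snd k)"
  define w0 where "w0 = ratio k"
  have s0: "s0 > 0" and keq: "k = (s0 *\<^sub>R w0, s0\<^sup>2)"
    using pos parabola_ratio [OF pos] by (simp_all add: s0_def w0_def)
  define F where "F w s = inner (n, \<alpha>) (s *\<^sub>R w, s\<^sup>2) - \<beta>" for w s
  define D where "D = 2 * \<alpha> * s0 + inner n w0"
  define g where "g s = D * (\<alpha> * (s + s0) + inner n w0)" for s
  obtain e where e: "e > 0" "ball k e \<inter> affine hull T \<subseteq> convex hull T"
    using k by (auto simp: mem_rel_interior_ball)
  have "k \<in> affine hull T"
    using k rel_interior_subset convex_hull_subset_affine_hull by blast
  then have F0: "F w0 s0 = 0" by (simp add: F_def plane flip: keq)
  \<comment> \<open>The factor \<open>D\<close>, the derivative at the contact point, normalizes the sign: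
    \<open>D * F w0\<close> passes from negative to positive at \<open>s0\<close>.\<close>
  have factor: "D * F w0 s = (s - s0) * g s" for s
  proof -
    have "F w0 s = F w0 s - F w0 s0" by (simp add: F0)
    also have "\<dots> = (s - s0) * (\<alpha> * (s + s0) + inner n w0)"
      by (simp add: F_def power2_eq_square algebra_simps)
    finally show ?thesis by (simp add: g_def)
  qed
  have "D \<noteq> 0" using transversal by (simp add: D_def s0_def w0_def)
  moreover have "g s0 = D\<^sup>2" by (simp add: g_def D_def power2_eq_square)
  ultimately have g0: "g s0 > 0" by simp
  let ?f = "\<lambda>(w, s). (s *\<^sub>R w, s\<^sup>2)"
  have "open (?f -` ball k e)"
    by (intro open_vimage) (auto intro!: continuous_intros simp: case_prod_unfold)
  moreover have "(w0, s0) \<in> ?f -` ball k e" using keq e by simp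
  ultimately obtain A B where "open A" "open B" "(w0, s0) \<in> A \<times> B" "A \<times> B \<subseteq> ?f -` ball k e"
    by (rule open_prod_elim)
  then have AB: "open A" "open B" "w0 \<in> A" "s0 \<in> B" "A \<times> B \<subseteq> ?f -` ball k e" by auto
  have "open (B \<inter> {s. g s > 0} \<inter> {0<..})"
    unfolding g_def using AB
    by (intro open_Int open_Collect_less open_greaterThan) (auto intro!: continuous_intros)
  moreover have "s0 \<in> B \<inter> {s. g s > 0} \<inter> {0<..}" using AB g0 s0 by simp
  ultimately obtain \<delta> where \<delta>: "\<delta> > 0" "cball s0 \<delta> \<subseteq> B \<inter> {s. g s > 0} \<inter> {0<..}"
    unfolding open_contains_cball by blast
  have near: "s \<in> B" "g s > 0" "s > 0" if "s0 - \<delta> \<le> s" "s \<le> s0 + \<delta>" for s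
    using \<delta>(2) that by (auto simp: subset_iff dist_real_def)
  define V where "V = A \<inter> {w. D * F w (s0 - \<delta>) < 0} \<inter> {w. D * F w (s0 + \<delta>) > 0}"
  have "open V"
    unfolding V_def F_def using AB
    by (intro open_Int open_Collect_less) (auto intro!: continuous_intros)
  moreover have "w0 \<in> V"
    using AB \<delta>(1) near [of "s0 - \<delta>"] near [of "s0 + \<delta>"] by (simp add: V_def factor)
  moreover have "V \<subseteq> spectral_range S"
  proof
    fix w assume w: "w \<in> V"
    have "continuous_on {s0 - \<delta>..s0 + \<delta>} (\<lambda>s. D * F w s)"
      unfolding F_def by (intro continuous_intros)
    then obtain s where s: "s0 - \<delta> \<le> s" "s \<le> s0 + \<delta>" "D * F w s = 0"
      using IVT' [of "\<lambda>s. D * F w s" "s0 - \<delta>" 0 "s0 + \<delta>"] w \<delta>(1) by (auto simp: V_def)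
    have "(s *\<^sub>R w, s\<^sup>2) \<in> ball k e"
      using AB(5) near [OF s(1,2)] w by (auto simp: V_def)
    moreover have "(s *\<^sub>R w, s\<^sup>2) \<in> affine hull T"
      using s(3) \<open>D \<noteq> 0\<close> by (simp add: plane F_def)
    ultimately have "(s *\<^sub>R w, s\<^sup>2) \<in> convex hull T" using e by blast
    then have "(s *\<^sub>R w, s\<^sup>2) \<in> convex hull (lift ` S)" using hull_mono [OF T] by blast
    then show "w \<in> spectral_range S"
      using ratioI_spectral_range [of "(s *\<^sub>R w, s\<^sup>2)" S] near [OF s(1,2)] ratio_parabola [of s w] by simp
  qed
  ultimately show ?thesis by (auto simp: w0_def intro: interiorI)
qed

text \<open>The parabola is unbounded, so there is a last parameter at which it is in the simplex. At that
  parameter it cannot be in the relative interior.\<close>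

lemma parabola_in_plane_meets_edge:
  assumes indep: "\<not> affine_dependent T" and k: "k \<in> convex hull T" and pos: "snd k > 0"
    and curve: "\<And>s. (s *\<^sub>R ratio k, s\<^sup>2) \<in> affine hull T"
  obtains x k' where "x \<in> T" "k' \<in> convex hull (T - {x})" "snd k' > 0" "ratio k' = ratio k"
proof -
  define \<kappa> where "\<kappa> s = (s *\<^sub>R ratio k, s\<^sup>2)" for s :: real
  define s0 where "s0 = sqrt (snd k)"
  have s0: "s0 > 0" and keq: "k = \<kappa> s0"
    using pos parabola_ratio [OF pos] by (simp_all add: s0_def \<kappa>_def)
  have fin: "finite T" using indep aff_independent_finite by blast
  then have cpt: "compact (convex hull T)" by (rule finite_imp_compact_convex_hull)
  have cont: "continuous_on X \<kappa>" for X unfolding \<kappa>_def by (intro continuous_intros)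
  define J where "J = {s0..} \<inter> \<kappa> -` (convex hull T)"
  have "closed J"
    unfolding J_def using cpt cont
    by (intro closed_Int closed_vimage) (auto intro: compact_imp_closed)
  moreover have "bounded J"
  proof -
    obtain M where M: "\<And>x. x \<in> convex hull T \<Longrightarrow> norm x \<le> M"
      using cpt compact_imp_bounded bounded_iff by metis
    have "norm s \<le> max 1 M" if "s \<in> J" for s
    proof -
      have "s\<^sup>2 \<le> norm (\<kappa> s)"
        using norm_snd_le [of "s\<^sup>2" "s *\<^sub>R ratio k"] by (simp add: \<kappa>_def)
      also have "\<dots> \<le> M" using that M by (simp add: J_def)
      finally have "s\<^sup>2 \<le> M" .
      moreover have "s > 0" using that s0 by (simp add: J_def)
      moreover have "s \<le> 1 \<or> s \<le> s\<^sup>2" using \<open>s > 0\<close> by (auto simp: power2_eq_square)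
      ultimately show ?thesis by auto
    qed
    then show ?thesis by (auto simp: bounded_iff)
  qed
  moreover have "s0 \<in> J" using k keq by (simp add: J_def)
  ultimately obtain s where s: "s \<in> J" "\<And>r. r \<in> J \<Longrightarrow> r \<le> s"
    using continuous_attains_sup [of J "\<lambda>x. x"] by (auto simp: compact_eq_bounded_closed)
  have "\<kappa> s \<notin> rel_interior (convex hull T)"
  proof
    assume "\<kappa> s \<in> rel_interior (convex hull T)"
    then obtain e where e: "e > 0" "ball (\<kappa> s) e \<inter> affine hull T \<subseteq> convex hull T"
      by (auto simp: mem_rel_interior_ball)
    have "open (\<kappa> -` ball (\<kappa> s) e)" using cont by (intro open_vimage) auto
    then obtain d where d: "d > 0" "cball s d \<subseteq> \<kappa> -` ball (\<kappa> s) e"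
      using open_contains_cball e(1) by (metis centre_in_ball vimageI2)
    moreover have "s + d \<in> cball s d" using d by (simp add: dist_real_def)
    ultimately have "s + d \<in> \<kappa> -` ball (\<kappa> s) e" by blast
    then have "\<kappa> (s + d) \<in> convex hull T" using e(2) curve by (auto simp: \<kappa>_def)
    then have "s + d \<in> J" using s(1) d by (simp add: J_def)
    then show False using s(2) d(1) by force
  qed
  then have "\<kappa> s \<in> rel_frontier (convex hull T)"
    using s(1) closure_subset by (auto simp: rel_frontier_def J_def)
  then obtain x where "x \<in> T" "\<kappa> s \<in> convex hull (T - {x})"
    using rel_frontier_convex_hull_cases [OF indep] by auto
  moreover have "s > 0" using s(1) s0 by (simp add: J_def)
  moreover then have "snd (\<kappa> s) > 0" "ratio (\<kappa> s) = ratio k"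
    by (simp_all add: \<kappa>_def ratio_parabola)
  ultimately show thesis using that by blast
qed

text \<open>The hypotheses say that the edge lies in a plane \<open>inner n z + \<alpha> h = - \<alpha> s\<^sup>2\<close>. Along the parabola
  of a point \<open>w\<close> with \<open>inner n w = - 2 \<alpha> s\<close> the defining function of this plane is
  \<open>\<alpha> (r - s)\<^sup>2\<close>: the line consists of the points whose parabolas touch the plane, always at height
  \<open>s\<^sup>2\<close>.\<close>

lemma tangent_line_atI:
  assumes n: "n \<noteq> 0" and ab: "inner n a + \<alpha> * (cmod a)\<^sup>2 = - \<alpha> * s\<^sup>2" "inner n b + \<alpha> * (cmod b)\<^sup>2 = - \<alpha> * s\<^sup>2"
    and t: "t \<in> {0..1}" and s: "s > 0" "snd (t *\<^sub>R lift a + (1 - t) *\<^sub>R lift b) = s\<^sup>2"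
  shows "tangent_line_at {w. inner n w = - 2 * \<alpha> * s} a b (arc_param a b t)"
proof -
  let ?D = "arc_dom a b"
  define h where "h \<tau> = \<tau> * (cmod a)\<^sup>2 + (1 - \<tau>) * (cmod b)\<^sup>2" for \<tau>
  define z where "z \<tau> = \<tau> *\<^sub>R a + (1 - \<tau>) *\<^sub>R b" for \<tau>
  define h' where "h' = (cmod a)\<^sup>2 - (cmod b)\<^sup>2"
  have tD: "t \<in> ?D" using t s by (simp add: arc_dom_iff del: snd_add snd_scaleR)
  have h: "h t = s\<^sup>2" using s(2) by (simp add: h_def lift_def)
  have sq: "sqrt (h t) = s" using h s(1) by simp
  have arc: "arc_param a b \<tau> = inverse (sqrt (h \<tau>)) *\<^sub>R z \<tau>" for \<tau>
    by (simp add: arc_param_eq_ratio ratio_def lift_def h_def z_def)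
  have nz: "inner n (z \<tau>) = - \<alpha> * s\<^sup>2 - \<alpha> * h \<tau>" for \<tau>
  proof -
    have a: "inner n a = - \<alpha> * s\<^sup>2 - \<alpha> * (cmod a)\<^sup>2" and b: "inner n b = - \<alpha> * s\<^sup>2 - \<alpha> * (cmod b)\<^sup>2"
      using ab by simp_all
    show ?thesis by (simp add: z_def h_def inner_add_right a b algebra_simps)
  qed
  have dh: "((\<lambda>\<tau>. inverse (sqrt (h \<tau>))) has_field_derivative (- h' / (2 * s ^ 3))) (at t within ?D)"
  proof -
    have "(h has_field_derivative h') (at t within ?D)"
      unfolding h_def by (auto intro!: derivative_eq_intros simp: h'_def)
    then show ?thesis
      using s(1) h sq
      by (auto intro!: derivative_eq_intros) (simp add: field_simps power2_eq_square power3_eq_cube)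
  qed
  have dz: "(z has_vector_derivative (a - b)) (at t within ?D)"
    unfolding z_def by (auto intro!: derivative_eq_intros)
  define v where "v = inverse (sqrt (h t)) *\<^sub>R (a - b) + (- h' / (2 * s ^ 3)) *\<^sub>R z t"
  have der: "(arc_param a b has_vector_derivative v) (at t within ?D)"
    unfolding arc v_def by (rule has_vector_derivative_scaleR [OF dh dz])
  have "inner n (a - b) = - \<alpha> * h'" using ab by (simp add: inner_diff_right h'_def algebra_simps)
  moreover have "inner n v = inverse s * inner n (a - b) + (- h' / (2 * s ^ 3)) * inner n (z t)"
    unfolding v_def sq inner_add_right inner_scaleR_right ..
  ultimately have "inner n v = 0"
    using s(1) by (simp add: nz h field_simps power2_eq_square power3_eq_cube)
  moreover have "inner n (arc_param a b t) = - 2 * \<alpha> * s"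
    using s(1) by (simp add: arc nz h power2_eq_square)
  moreover have "aff_dim {w. inner n w = - 2 * \<alpha> * s} = 1"
    using n by simp
  ultimately show ?thesis
    unfolding tangent_line_at_def using tD der affine_hyperplane
    by (auto simp: inner_add_right intro!: bexI [of _ t] exI [of _ v])
qed

text \<open>The section of the triangle at height \<open>s\<^sup>2\<close> joins the two edges at the vertex \<open>b\<close> that is alone
  on its side of this height. Its end points project to the tangency points \<open>ratio p\<close> and \<open>ratio q\<close>,
  and at constant height the projection is affine, so a point of the section with weights
  \<open>u, v, w\<close> lies on the segment with coefficients \<open>u / \<mu>\<close> and \<open>w / \<nu>\<close>.\<close>

lemma level_section_in_bitangent_segment:
  assumes n: "n \<noteq> 0" and s: "s > 0"
    and plane: "\<And>x. x \<in> {a, b, c} \<Longrightarrow> inner n x + \<alpha> * (cmod x)\<^sup>2 = - \<alpha> * s\<^sup>2"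
    and dist: "a \<noteq> b" "b \<noteq> c" "a \<noteq> c"
    and order: "(cmod b)\<^sup>2 < s\<^sup>2 \<and> s\<^sup>2 \<le> (cmod a)\<^sup>2 \<and> s\<^sup>2 \<le> (cmod c)\<^sup>2
      \<or> s\<^sup>2 < (cmod b)\<^sup>2 \<and> (cmod a)\<^sup>2 \<le> s\<^sup>2 \<and> (cmod c)\<^sup>2 \<le> s\<^sup>2"
  obtains \<Sigma> where "\<Sigma> \<in> bitangent_segments {a, b, c}"
    "\<And>k. k \<in> convex hull (lift ` {a, b, c}) \<Longrightarrow> snd k = s\<^sup>2 \<Longrightarrow> ratio k \<in> \<Sigma>"
proof -
  define A where "A = (cmod a)\<^sup>2 - (cmod b)\<^sup>2"
  define C where "C = (cmod c)\<^sup>2 - (cmod b)\<^sup>2"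
  define l where "l = s\<^sup>2 - (cmod b)\<^sup>2"
  define \<mu> where "\<mu> = l / A"
  define \<nu> where "\<nu> = l / C"
  have \<mu>: "0 < \<mu>" "\<mu> \<le> 1" "A \<noteq> 0" and \<nu>: "0 < \<nu>" "\<nu> \<le> 1" "C \<noteq> 0"
    using order by (auto simp: \<mu>_def \<nu>_def l_def A_def C_def zero_less_divide_iff divide_le_eq)
  have "l \<noteq> 0" using order by (auto simp: l_def)
  define p where "p = \<mu> *\<^sub>R lift a + (1 - \<mu>) *\<^sub>R lift b"
  define q where "q = (1 - \<nu>) *\<^sub>R lift b + \<nu> *\<^sub>R lift c"
  have "\<mu> * A = l" "\<nu> * C = l" using \<mu> \<nu> by (simp_all add: \<mu>_def \<nu>_def)
  then have p2: "snd p = s\<^sup>2" and q2: "snd q = s\<^sup>2"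
    by (simp_all add: p_def q_def lift_def A_def C_def l_def algebra_simps)
  have "tangent_line_at {w. inner n w = - 2 * \<alpha> * s} a b (ratio p)"
    unfolding p_def arc_param_eq_ratio [symmetric] using n s plane \<mu> p2
    by (intro tangent_line_atI) (auto simp: p_def)
  moreover have "tangent_line_at {w. inner n w = - 2 * \<alpha> * s} b c (ratio q)"
    using tangent_line_atI [of n b \<alpha> s c "1 - \<nu>"] n s plane \<nu> q2
    by (auto simp: q_def arc_param_eq_ratio)
  ultimately have "closed_segment (ratio p) (ratio q) \<in> bitangent_segments {a, b, c}"
    unfolding bitangent_segments_def using dist by blast
  moreover have "ratio k \<in> closed_segment (ratio p) (ratio q)"
    if k: "k \<in> convex hull (lift ` {a, b, c})" "snd k = s\<^sup>2" for k
  proof -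
    obtain u v w where uvw: "0 \<le> u" "0 \<le> v" "0 \<le> w" "u + v + w = 1"
      and keq: "k = u *\<^sub>R lift a + v *\<^sub>R lift b + w *\<^sub>R lift c"
      using k(1) by (auto simp: convex_hull_3)
    have v: "v = 1 - u - w" using uvw by simp
    have "u * A + w * C = l"
      using k(2) by (simp add: keq lift_def A_def C_def l_def v algebra_simps)
    then have sum1: "u / \<mu> + w / \<nu> = 1"
      using \<open>l \<noteq> 0\<close> by (simp add: \<mu>_def \<nu>_def add_divide_distrib [symmetric])
    have "k = (u / \<mu>) *\<^sub>R p + (w / \<nu>) *\<^sub>R q"
    proof -
      have "(u / \<mu>) *\<^sub>R p + (w / \<nu>) *\<^sub>R q = u *\<^sub>R lift a + (u / \<mu> - u + (w / \<nu> - w)) *\<^sub>R lift b + w *\<^sub>R lift c"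
        using \<mu> \<nu> by (simp add: p_def q_def algebra_simps)
      also have "u / \<mu> - u + (w / \<nu> - w) = v" using sum1 v by simp
      finally show ?thesis by (simp add: keq)
    qed
    then have fk: "fst k = (u / \<mu>) *\<^sub>R fst p + (w / \<nu>) *\<^sub>R fst q"
      unfolding fst_add [symmetric] fst_scaleR [symmetric] by (rule arg_cong)
    have rat: "ratio x = inverse s *\<^sub>R fst x" if "snd x = s\<^sup>2" for x
      using s by (simp add: ratio_def that)
    have "ratio k = (u / \<mu>) *\<^sub>R ratio p + (w / \<nu>) *\<^sub>R ratio q"
      unfolding rat [OF k(2)] rat [OF p2] rat [OF q2] fk by (simp add: scaleR_add_right mult.commute)
    moreover have "u / \<mu> = 1 - w / \<nu>" using sum1 by simp
    moreover have "0 \<le> w / \<nu>" "0 \<le> u / \<mu>" using uvw \<mu> \<nu> by simp_all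
    ultimately show ?thesis unfolding in_segment by (intro exI [of _ "w / \<nu>"]) simp
  qed
  ultimately show thesis using that by blast
qed

text \<open>This picks the vertex that is alone on its side of the contact height.\<close>

lemma weighted_signs_split:
  fixes A B C :: real
  assumes pos: "0 < u" "0 < v" "0 < w" and sum: "u * A + v * B + w * C = 0"
    and ne: "\<not> (A = 0 \<and> B = 0 \<and> C = 0)"
  shows "(B < 0 \<and> 0 \<le> A \<and> 0 \<le> C \<or> 0 < B \<and> A \<le> 0 \<and> C \<le> 0)
    \<or> (A < 0 \<and> 0 \<le> B \<and> 0 \<le> C \<or> 0 < A \<and> B \<le> 0 \<and> C \<le> 0)
    \<or> (C < 0 \<and> 0 \<le> A \<and> 0 \<le> B \<or> 0 < C \<and> A \<le> 0 \<and> B \<le> 0)"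
proof -
  have "\<not> (0 \<le> A \<and> 0 \<le> B \<and> 0 \<le> C)"
  proof
    assume nn: "0 \<le> A \<and> 0 \<le> B \<and> 0 \<le> C"
    then have "0 \<le> u * A" "0 \<le> v * B" "0 \<le> w * C" using pos by simp_all
    then have "u * A = 0" "v * B = 0" "w * C = 0" using sum by linarith+
    then show False using pos ne by simp
  qed
  moreover have "\<not> (A \<le> 0 \<and> B \<le> 0 \<and> C \<le> 0)"
  proof
    assume nn: "A \<le> 0 \<and> B \<le> 0 \<and> C \<le> 0"
    then have "u * A \<le> 0" "v * B \<le> 0" "w * C \<le> 0" using pos by (simp_all add: mult_le_0_iff)
    then have "u * A = 0" "v * B = 0" "w * C = 0" using sum by linarith+
    then show False using pos ne by simp
  qed
  ultimately show ?thesis by linarith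
qed

text \<open>One segment per triangle suffices: the height at which a parabola can touch the plane of the
  triangle is determined by the plane. Thus only finitely many bitangent segments are used in the
  end, which keeps their union closed.\<close>

lemma triangle_interior_or_curve:
  assumes dist: "a \<noteq> b" "b \<noteq> c" "a \<noteq> c" and dim: "aff_dim (lift ` {a, b, c}) = 2"
  obtains B where "finite B" "B \<subseteq> bitangent_segments {a, b, c}"
    "\<And>k. k \<in> rel_interior (convex hull (lift ` {a, b, c})) \<Longrightarrow> snd k > 0 \<Longrightarrow>
      ratio k \<in> interior (spectral_range {a, b, c})
        \<union> (spectral_range {a, b} \<union> spectral_range {b, c} \<union> spectral_range {a, c}) \<union> \<Union>B"
proof -
  define T where "T = lift ` {a, b, c}"
  note found = that [folded T_def]
  have dimT: "aff_dim T = 2" unfolding T_def by (rule dim)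
  let ?edges = "spectral_range {a, b} \<union> spectral_range {b, c} \<union> spectral_range {a, c}"
  have "card T = card {a, b, c}" unfolding T_def by (rule card_image [OF inj_lift])
  then have "card T = 3" using dist by simp
  then have indep: "\<not> affine_dependent T"
    using dimT by (simp add: affine_independent_iff_card card_ge_0_finite)
  have "aff_dim T = DIM(complex \<times> real) - 1" using dimT by simp
  from this [unfolded aff_dim_eq_hyperplane]
  obtain N \<beta> where N: "affine hull T = {x. inner N x = \<beta>}"
    by (elim exE conjE) (rule that)
  define n \<alpha> where "n = fst N" and "\<alpha> = snd N"
  have plane: "affine hull T = {x. inner (n, \<alpha>) x = \<beta>}"
    unfolding n_def \<alpha>_def prod.collapse by (rule N)
  define crit where "crit k \<longleftrightarrow> k \<in> rel_interior (convex hull T) \<and> snd k > 0 \<and>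
    2 * \<alpha> * sqrt (snd k) + inner n (ratio k) = 0" for k
  have noncrit: "ratio k \<in> interior (spectral_range {a, b, c})"
    if "k \<in> rel_interior (convex hull T)" "snd k > 0" "\<not> crit k" for k
    by (rule interior_spectral_range_transversal [OF that(1) equalityD1 [OF T_def] that(2) plane])
      (use that in \<open>simp add: crit_def\<close>)
  have crit_hull: "k \<in> convex hull T" "k \<in> affine hull T" "snd k > 0" if "crit k" for k
  proof -
    have "k \<in> rel_interior (convex hull T)" and "snd k > 0" using that by (simp_all add: crit_def)
    then show "k \<in> convex hull T" "snd k > 0" using subsetD [OF rel_interior_subset] by simp_all
    then show "k \<in> affine hull T" by (intro subsetD [OF convex_hull_subset_affine_hull])
  qed
  have crit_eq: "\<beta> = - \<alpha> * snd k" if "crit k" for k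
  proof -
    define s where "s = sqrt (snd k)"
    have s: "s > 0" "snd k = s\<^sup>2" using crit_hull [OF that] by (simp_all add: s_def)
    have "fst k = s *\<^sub>R ratio k" using s by (simp add: ratio_def)
    moreover have "inner n (ratio k) = - 2 * \<alpha> * s" using that by (simp add: crit_def s_def)
    ultimately have "inner n (fst k) = - 2 * \<alpha> * s\<^sup>2" by (simp add: power2_eq_square)
    moreover have "inner n (fst k) + \<alpha> * snd k = \<beta>"
      using crit_hull [OF that] by (simp add: plane inner_prod_def)
    ultimately show ?thesis using s by simp
  qed
  have finish: thesis if B: "finite B" "B \<subseteq> bitangent_segments {a, b, c}"
    and crit_cover: "\<And>k. crit k \<Longrightarrow> ratio k \<in> ?edges \<union> \<Union>B" for B
  proof (rule found [OF B])
    fix k assume k: "k \<in> rel_interior (convex hull T)" "snd k > 0"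
    show "ratio k \<in> interior (spectral_range {a, b, c}) \<union> ?edges \<union> \<Union>B"
    proof (cases "crit k")
      case True
      then have "ratio k \<in> ?edges \<union> \<Union>B" by (rule crit_cover)
      then show ?thesis by blast
    next
      case False
      then show ?thesis using noncrit [OF k] by blast
    qed
  qed
  show thesis
  proof (cases "\<exists>k. crit k")
    case False
    then show thesis by (intro finish [of "{}"]) auto
  next
    case True
    then obtain k0 where k0: "crit k0" by blast
    define s where "s = sqrt (snd k0)"
    have s: "s > 0" "snd k0 = s\<^sup>2" using crit_hull [OF k0] by (simp_all add: s_def)
    show thesis
    proof (cases "\<alpha> = 0")
      case True
      have "ratio k \<in> ?edges" if k: "crit k" for k
      proof -
        have "inner n (ratio k) = 0" "\<beta> = 0" using k True crit_eq [OF k] by (simp_all add: crit_def)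
        then have curve: "(r *\<^sub>R ratio k, r\<^sup>2) \<in> affine hull T" for r
          by (simp add: plane True)
        obtain x k' where x: "x \<in> T" "k' \<in> convex hull (T - {x})" "snd k' > 0" "ratio k' = ratio k"
          by (rule parabola_in_plane_meets_edge [OF indep crit_hull(1) [OF k] crit_hull(3) [OF k] curve])
        from x(1) obtain y where y: "y \<in> {a, b, c}" "x = lift y" unfolding T_def by blast
        have "T - {x} = lift ` ({a, b, c} - {y})"
          unfolding T_def y(2) image_set_diff [OF inj_lift [of UNIV]] by simp
        then have "ratio k \<in> spectral_range ({a, b, c} - {y})"
          using ratioI_spectral_range [of k' "{a, b, c} - {y}"] x by simp
        moreover have "{a, b, c} - {y} \<subseteq> {a, b} \<or> {a, b, c} - {y} \<subseteq> {b, c} \<or> {a, b, c} - {y} \<subseteq> {a, c}"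
          using y(1) by blast
        ultimately show ?thesis using spectral_range_mono by blast
      qed
      then show thesis by (intro finish [of "{}"]) simp_all
    next
      case False
      have n: "n \<noteq> 0" using k0 False s by (auto simp: crit_def)
      have pts: "inner n x + \<alpha> * (cmod x)\<^sup>2 = - \<alpha> * s\<^sup>2" if "x \<in> {a, b, c}" for x
      proof -
        have "lift x \<in> affine hull T" using that by (intro hull_inc) (auto simp: T_def)
        then show ?thesis using crit_eq [OF k0] s by (simp add: plane lift_def)
      qed
      have level: "snd k = s\<^sup>2" if "crit k" for k
        using crit_eq [OF that] crit_eq [OF k0] False s by simp
      \<comment> \<open>The plane is not horizontal, because \<open>n \<noteq> 0\<close>.\<close>
      have ne: "\<not> (\<forall>x\<in>{a, b, c}. (cmod x)\<^sup>2 = s\<^sup>2)"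
      proof
        assume "\<forall>x\<in>{a, b, c}. (cmod x)\<^sup>2 = s\<^sup>2"
        then have "T \<subseteq> {x. inner (0, 1) x = s\<^sup>2}" by (auto simp: lift_def T_def)
        then have *: "affine hull T \<subseteq> {x. inner (0, 1) x = s\<^sup>2}"
          by (intro hull_minimal affine_hyperplane)
        have "k0 + ((- \<alpha> / inner n n) *\<^sub>R n, 1) \<in> affine hull T"
          using crit_hull(2) [OF k0] n by (simp add: plane inner_add_right)
        then have "inner (0, 1) (k0 + ((- \<alpha> / inner n n) *\<^sub>R n, 1)) = s\<^sup>2" using * by blast
        then show False using s by (simp add: inner_prod_def)
      qed
      obtain t where t: "\<forall>x\<in>T. 0 < t x" "sum t T = 1" "(\<Sum>x\<in>T. t x *\<^sub>R x) = k0"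
        using k0 unfolding crit_def rel_interior_convex_hull_explicit [OF indep] by blast
      have "lift a \<noteq> lift b" "lift b \<noteq> lift c" "lift a \<noteq> lift c" using dist by (auto simp: lift_def)
      then have "t (lift a) + t (lift b) + t (lift c) = 1"
        and k0eq: "t (lift a) *\<^sub>R lift a + t (lift b) *\<^sub>R lift b + t (lift c) *\<^sub>R lift c = k0"
        using t(2,3) by (simp_all add: add.assoc T_def)
      then have tc: "t (lift c) = 1 - t (lift a) - t (lift b)" by simp
      have "t (lift a) * (cmod a)\<^sup>2 + t (lift b) * (cmod b)\<^sup>2 + t (lift c) * (cmod c)\<^sup>2 = s\<^sup>2"
        using arg_cong [OF k0eq, of snd] s(2) by (simp add: lift_def)
      then have zero: "t (lift a) * ((cmod a)\<^sup>2 - s\<^sup>2) + t (lift b) * ((cmod b)\<^sup>2 - s\<^sup>2)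
          + t (lift c) * ((cmod c)\<^sup>2 - s\<^sup>2) = 0"
        unfolding tc by (simp add: algebra_simps)
      define apex where "apex x y z \<longleftrightarrow> (cmod y)\<^sup>2 < s\<^sup>2 \<and> s\<^sup>2 \<le> (cmod x)\<^sup>2 \<and> s\<^sup>2 \<le> (cmod z)\<^sup>2
          \<or> s\<^sup>2 < (cmod y)\<^sup>2 \<and> (cmod x)\<^sup>2 \<le> s\<^sup>2 \<and> (cmod z)\<^sup>2 \<le> s\<^sup>2" for x y z
      have lsec: "\<exists>\<Sigma>\<in>bitangent_segments {a, b, c}.
          \<forall>k\<in>convex hull T. snd k = s\<^sup>2 \<longrightarrow> ratio k \<in> \<Sigma>"
        if "apex x y z" "x \<noteq> y" "y \<noteq> z" "x \<noteq> z" and perm: "{x, y, z} = {a, b, c}" for x y z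
        using level_section_in_bitangent_segment [OF n s(1) pts [folded perm] that(2-4) that(1) [unfolded apex_def]]
        unfolding perm T_def by metis
      have "apex a b c \<or> apex b a c \<or> apex a c b"
        using weighted_signs_split [OF _ _ _ zero] t(1) ne by (simp add: apex_def T_def)
      then obtain \<Sigma> where \<Sigma>: "\<Sigma> \<in> bitangent_segments {a, b, c}"
        "\<And>k. k \<in> convex hull T \<Longrightarrow> snd k = s\<^sup>2 \<Longrightarrow> ratio k \<in> \<Sigma>"
        using lsec [of a b c] lsec [of b a c] lsec [of a c b] dist
        by (metis insert_commute)
      have "ratio k \<in> \<Sigma>" if "crit k" for k
        using \<Sigma>(2) level [OF that] crit_hull(1) [OF that] by blast
      then show thesis using \<Sigma>(1) by (intro finish [of "{\<Sigma>}"]) simp_all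
    qed
  qed
qed

lemma arcs_mono: "S \<subseteq> T \<Longrightarrow> arcs S \<subseteq> arcs T"
  unfolding arcs_def by blast

lemma bitangent_segments_mono: "S \<subseteq> T \<Longrightarrow> bitangent_segments S \<subseteq> bitangent_segments T"
  unfolding bitangent_segments_def by blast

text \<open>Take a subset of least cardinality whose convex hull contains the point. Caratheodory's theorem
  makes it affinely independent, and a point on its relative frontier would lie in the hull of a
  smaller subset.\<close>

lemma convex_hull_minimal_subset:
  fixes k :: "'a::euclidean_space"
  assumes "k \<in> convex hull P"
  obtains T where "T \<subseteq> P" "\<not> affine_dependent T" "k \<in> rel_interior (convex hull T)"
proof -
  let ?Q = "\<lambda>T. finite T \<and> T \<subseteq> P \<and> k \<in> convex hull T"
  have step: "\<exists>T'. finite T' \<and> T' \<subseteq> X \<and> card T' \<le> aff_dim X + 1 \<and> k \<in> convex hull T'"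
    if "k \<in> convex hull X" for X
  proof -
    from that obtain T' u where "finite T'" "T' \<subseteq> X" "card T' \<le> aff_dim X + 1"
      "\<forall>x\<in>T'. 0 \<le> u x" "sum u T' = 1" "(\<Sum>v\<in>T'. u v *\<^sub>R v) = k"
      unfolding convex_hull_caratheodory_aff_dim by blast
    then show ?thesis by (intro exI [of _ T']) (auto simp: convex_hull_finite)
  qed
  obtain T0 where "?Q T0" using step [OF assms] by blast
  from ex_has_least_nat [of ?Q, OF this, of card] obtain T where T: "?Q T" and min: "\<And>T'. ?Q T' \<Longrightarrow> card T \<le> card T'"
    by auto
  obtain T' where T': "finite T'" "T' \<subseteq> T" "card T' \<le> aff_dim T + 1" "k \<in> convex hull T'"
    using step [of T] T by blast
  have "card T \<le> card T'" using T' T by (intro min) auto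
  then have "aff_dim T = int (card T) - 1"
    using T' aff_dim_le_card [of T] T by linarith
  then have indep: "\<not> affine_dependent T" using T by (simp add: affine_independent_iff_card)
  have "k \<in> rel_interior (convex hull T)"
  proof (rule ccontr)
    assume "k \<notin> rel_interior (convex hull T)"
    then have "k \<in> rel_frontier (convex hull T)"
      using T closure_subset [THEN subsetD] unfolding rel_frontier_def by blast
    then obtain x where x: "x \<in> T" "k \<in> convex hull (T - {x})"
      using rel_frontier_convex_hull_cases [OF indep] by auto
    then have "card T \<le> card (T - {x})" using T by (intro min) auto
    moreover have "card (T - {x}) < card T" using T x by (intro card_Diff1_less) auto
    ultimately show False by simp
  qed
  then show thesis using that T indep by blast
qed

text \<open>The case distinction is by the number of vertices needed to span the contact point. Each
  triangle contributes its own finite set of segments, so that their union is still finite.\<close>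

lemma spectral_range_interior_or_curve:
  assumes fin: "finite S" and card: "card S \<ge> 2"
  obtains B where "finite B" "B \<subseteq> bitangent_segments S"
    "spectral_range S \<subseteq> interior (spectral_range S) \<union> \<Union>(arcs S) \<union> \<Union>B"
proof -
  have pair: "spectral_range {x, y} \<subseteq> \<Union>(arcs S)" if "x \<in> S" "y \<in> S" "x \<noteq> y" for x y
    using that unfolding arcs_def hyp_arc_eq_spectral_range by blast
  define good where "good a b c B \<longleftrightarrow> finite B \<and> B \<subseteq> bitangent_segments {a, b, c} \<and>
    (\<forall>T k. a \<noteq> b \<longrightarrow> b \<noteq> c \<longrightarrow> a \<noteq> c \<longrightarrow> T = lift ` {a, b, c} \<longrightarrow> aff_dim T = 2 \<longrightarrow>
      k \<in> rel_interior (convex hull T) \<longrightarrow> snd k > 0 \<longrightarrow>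
      ratio k \<in> interior (spectral_range {a, b, c})
        \<union> (spectral_range {a, b} \<union> spectral_range {b, c} \<union> spectral_range {a, c}) \<union> \<Union>B)" for a b c B
  have "\<exists>B. good a b c B" for a b c
  proof (cases "a \<noteq> b \<and> b \<noteq> c \<and> a \<noteq> c \<and> aff_dim (lift ` {a, b, c}) = 2")
    case True
    then have "a \<noteq> b" "b \<noteq> c" "a \<noteq> c" "aff_dim (lift ` {a, b, c}) = 2" by blast+
    then obtain B where B: "finite B" "B \<subseteq> bitangent_segments {a, b, c}"
      "\<And>k. k \<in> rel_interior (convex hull (lift ` {a, b, c})) \<Longrightarrow> snd k > 0 \<Longrightarrow>
        ratio k \<in> interior (spectral_range {a, b, c})
          \<union> (spectral_range {a, b} \<union> spectral_range {b, c} \<union> spectral_range {a, c}) \<union> \<Union>B"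
      by (rule triangle_interior_or_curve) (rule that)
    have "good a b c B" unfolding good_def
      by (intro conjI allI impI B(1,2)) (rule B(3), simp_all only:)
    then show ?thesis by blast
  next
    case False
    then have "good a b c {}" unfolding good_def by blast
    then show ?thesis by blast
  qed
  then obtain f where f: "\<And>a b c. good a b c (f a b c)" by metis
  define B where "B = (\<Union>a\<in>S. \<Union>b\<in>S. \<Union>c\<in>S. f a b c)"
  have "finite (f a b c)" and fb: "f a b c \<subseteq> bitangent_segments {a, b, c}" for a b c
    using f [of a b c] unfolding good_def by blast+
  then have "finite B" using fin by (simp add: B_def)
  moreover have "f a b c \<subseteq> bitangent_segments S" if "a \<in> S" "b \<in> S" "c \<in> S" for a b c
    using fb [of a b c] bitangent_segments_mono [of "{a, b, c}" S] that by simp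
  then have "B \<subseteq> bitangent_segments S" unfolding B_def by blast
  moreover have "ratio k \<in> interior (spectral_range S) \<union> \<Union>(arcs S) \<union> \<Union>B"
    if k: "k \<in> convex hull (lift ` S)" "snd k > 0" for k
  proof -
    obtain T where T: "T \<subseteq> lift ` S" "\<not> affine_dependent T" "k \<in> rel_interior (convex hull T)"
      by (rule convex_hull_minimal_subset [OF k(1)])
    then obtain U where U: "U \<subseteq> S" "T = lift ` U" by (meson subset_imageE)
    have finU: "finite U" using U fin finite_subset by blast
    have cU: "card T = card U" using U by (simp add: card_image [OF inj_lift])
    have dim: "aff_dim T = int (card U) - 1"
      using T(2) by (simp add: affine_independent_iff_card cU)
    have kT: "k \<in> convex hull (lift ` U)" using T(3) subsetD [OF rel_interior_subset] unfolding U(2) by simp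
    have "U \<noteq> {}" using kT by auto
    consider "card U \<le> 2" | "card U = 3" | "card U \<ge> 4" by linarith
    then show ?thesis
    proof cases
      case 1
      then obtain x where x: "x \<in> U" using \<open>U \<noteq> {}\<close> by blast
      obtain y where y: "y \<in> S" "y \<noteq> x" "U \<subseteq> {x, y}"
      proof (cases "U = {x}")
        case True
        have "S \<noteq> {x}" using card by auto
        then show ?thesis using that True x U(1) by blast
      next
        case False
        then obtain y where y: "y \<in> U" "y \<noteq> x" using x by blast
        then have "{x, y} = U" using x finU 1 by (intro card_seteq) auto
        then show ?thesis using that y U(1) by blast
      qed
      have "k \<in> convex hull (lift ` {x, y})"
        using kT hull_mono [OF image_mono [OF y(3)], of convex lift] by blast
      then have "ratio k \<in> spectral_range {x, y}" using k(2) by (rule ratioI_spectral_range)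
      then show ?thesis using pair [of x y] x y U(1) by blast
    next
      case 2
      then obtain a b c where abc: "U = {a, b, c}" "a \<noteq> b" "b \<noteq> c" "a \<noteq> c"
        by (metis card_3_iff)
      have "ratio k \<in> interior (spectral_range {a, b, c})
        \<union> (spectral_range {a, b} \<union> spectral_range {b, c} \<union> spectral_range {a, c}) \<union> \<Union>(f a b c)"
      proof -
        have "T = lift ` {a, b, c}" "aff_dim T = 2" using U(2) dim 2 by (simp_all only: abc(1))
        then show ?thesis using f [of a b c] abc(2-4) T(3) k(2) unfolding good_def by blast
      qed
      moreover have "interior (spectral_range {a, b, c}) \<subseteq> interior (spectral_range S)"
        using U abc by (intro interior_mono spectral_range_mono) auto
      moreover have "spectral_range {a, b} \<union> spectral_range {b, c} \<union> spectral_range {a, c} \<subseteq> \<Union>(arcs S)"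
        using abc U(1) by (intro Un_least pair) auto
      moreover have "f a b c \<subseteq> B" using abc(1) U(1) unfolding B_def by blast
      then have "\<Union>(f a b c) \<subseteq> \<Union>B" by (rule Union_mono)
      ultimately show ?thesis by blast
    next
      case 3
      then have "aff_dim T = int (DIM(complex \<times> real))"
        using dim aff_dim_le_DIM [of T] by simp
      then have "affine hull (convex hull T) = UNIV"
        by (simp only: affine_hull_convex_hull aff_dim_eq_full)
      then have "k \<in> interior (convex hull T)" using T(3) by (simp add: rel_interior_interior)
      moreover have "interior (convex hull T) \<subseteq> interior (convex hull (lift ` S))"
        using T(1) by (intro interior_mono hull_mono)
      ultimately have "ratio k \<in> interior (spectral_range S)"
        using k(2) by (intro interior_spectral_range) auto
      then show ?thesis by blast
    qed
  qed
  then have "spectral_range S \<subseteq> interior (spectral_range S) \<union> \<Union>(arcs S) \<union> \<Union>B"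
    unfolding spectral_range_def by blast
  ultimately show thesis by (rule that)
qed

section \<open>The enclosed set\<close>

lemma enclosed_mono: "C \<subseteq> D \<Longrightarrow> enclosed C \<subseteq> enclosed D"
  unfolding enclosed_def by (intro Un_mono Union_mono UN_mono Pow_mono order_refl)

text \<open>A connected set that leaves \<open>U\<close> crosses the frontier of \<open>U\<close>.\<close>

lemma mem_inside_of_bounded_region:
  assumes "w \<in> U" "w \<notin> E" "bounded U" "frontier U \<subseteq> E"
  shows "w \<in> inside E"
proof -
  let ?C = "connected_component_set (- E) w"
  have wC: "w \<in> ?C" using assms(2) by simp
  have sub: "?C \<subseteq> - E" by (rule connected_component_subset)
  have "?C \<subseteq> U"
  proof (rule ccontr)
    assume "\<not> ?C \<subseteq> U"
    then have "?C - U \<noteq> {}" by blast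
    moreover have "?C \<inter> U \<noteq> {}" using wC assms(1) by blast
    ultimately have "?C \<inter> frontier U \<noteq> {}"
      by (intro connected_Int_frontier connected_connected_component)
    then show False using sub assms(4) by blast
  qed
  then have "bounded ?C" using assms(3) bounded_subset by blast
  then show ?thesis using assms(2) by (simp add: inside_def)
qed

lemma zero_in_closure_spectral_range:
  assumes "0 \<in> S" "a \<in> S" "a \<noteq> 0"
  shows "0 \<in> closure (spectral_range S)"
proof -
  let ?u = "a /\<^sub>R cmod a"
  have "inverse (real (Suc i)) *\<^sub>R ?u \<in> spectral_range S" for i
    using assms by (intro spectral_range_scale unit_in_spectral_range) (auto simp: field_simps)
  moreover have "(\<lambda>i. inverse (real (Suc i)) *\<^sub>R ?u) \<longlonglongrightarrow> 0 *\<^sub>R ?u"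
    by (intro tendsto_intros LIMSEQ_inverse_real_of_nat)
  ultimately show ?thesis
    unfolding closure_sequential by (intro exI [of _ "\<lambda>i. inverse (real (Suc i)) *\<^sub>R ?u"]) simp
qed

lemma finite_arcs: "finite S \<Longrightarrow> finite (arcs S)"
proof -
  assume "finite S"
  moreover have "arcs S \<subseteq> (\<lambda>(a, b). hyp_arc a b) ` (S \<times> S)" by (auto simp: arcs_def)
  ultimately show ?thesis by (meson finite_SigmaI finite_imageI finite_subset)
qed

text \<open>The finitely many curves \<open>D\<close> cover the frontier of the range, up to the origin, which in
  that case is the missing end point of an arc. Hence a point of the range off these curves
  is inside of them. The condition on \<open>w\<close> ensures that \<open>w\<close> is not an end point missing from an arc,
  which would lie in the closure of the curves.\<close>

lemma spectral_range_point_enclosed: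
  assumes fin: "finite S" and card: "card S \<ge> 2" and w: "w \<in> spectral_range S" and w0: "w \<noteq> 0 \<or> 0 \<notin> S"
  shows "w \<in> enclosed (arcs S \<union> bitangent_segments S)"
proof -
  obtain B where B: "finite B" "B \<subseteq> bitangent_segments S"
    and cover: "spectral_range S \<subseteq> interior (spectral_range S) \<union> \<Union>(arcs S) \<union> \<Union>B"
    by (rule spectral_range_interior_or_curve [OF fin card])
  define D where "D = arcs S \<union> B"
  have D: "D \<subseteq> arcs S \<union> bitangent_segments S" using B by (auto simp: D_def)
  define E where "E = closure (\<Union>D)"
  have DE: "\<Union>D \<subseteq> E" by (simp add: E_def closure_subset)
  have finD: "finite D" using B finite_arcs [OF fin] by (simp add: D_def)
  have arc0: "compact (insert 0 (hyp_arc a b))" for a b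
    by (simp add: hyp_arc_eq_spectral_range compact_insert_zero_spectral_range)
  have "compact (insert 0 X)" if "X \<in> D" for X
    using that B arc0 by (auto simp: D_def arcs_def bitangent_segments_def)
  then have "closed (insert 0 X)" if "X \<in> D" for X using that compact_imp_closed by blast
  then have "closed ({0} \<union> (\<Union>X\<in>D. insert 0 X))" using finD by (intro closed_Un closed_UN) auto
  moreover have "{0} \<union> (\<Union>X\<in>D. insert 0 X) = insert 0 (\<Union>D)" by auto
  ultimately have "closed (insert 0 (\<Union>D))" by simp
  then have E0: "E \<subseteq> insert 0 (\<Union>D)" unfolding E_def by (intro closure_minimal) auto
  have closedD: "E \<subseteq> \<Union>D" if "0 \<notin> S"
  proof -
    have "closed X" if "X \<in> D" for X
    proof (cases "X \<in> B")
      case True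
      then show ?thesis using B(2) by (auto simp: bitangent_segments_def)
    next
      case False
      then obtain a b where "X = hyp_arc a b" "a \<in> S" "b \<in> S" using \<open>X \<in> D\<close> by (auto simp: D_def arcs_def)
      then show ?thesis using \<open>0 \<notin> S\<close>
        by (auto simp: hyp_arc_eq_spectral_range intro!: compact_imp_closed compact_spectral_range)
    qed
    then have "closed (\<Union>D)" using finD by (intro closed_Union) auto
    then show ?thesis by (simp add: E_def)
  qed
  show ?thesis
  proof (cases "w \<in> \<Union>D")
    case True
    then show ?thesis using D unfolding enclosed_def by blast
  next
    case False
    then have wE: "w \<notin> E" using w0 E0 closedD by blast
    have cpt: "compact (insert 0 (spectral_range S))" using fin by (rule compact_insert_zero_spectral_range)
    have "frontier (spectral_range S) \<subseteq> E"
    proof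
      fix x assume "x \<in> frontier (spectral_range S)"
      then have x: "x \<in> closure (spectral_range S)" "x \<notin> interior (spectral_range S)"
        by (auto simp: frontier_def)
      show "x \<in> E"
      proof (cases "x \<in> spectral_range S")
        case True
        then have "x \<in> \<Union>D" using cover x(2) by (auto simp: D_def)
        then show ?thesis using DE by blast
      next
        case False
        have "closure (spectral_range S) \<subseteq> insert 0 (spectral_range S)"
          using cpt by (intro closure_minimal compact_imp_closed) auto
        then have "x = 0" using x(1) False by blast
        have "0 \<in> S"
        proof (rule ccontr)
          assume "0 \<notin> S"
          then have "closed (spectral_range S)" by (intro compact_imp_closed compact_spectral_range fin)
          then show False using x(1) False by (simp add: closure_closed)
        qed
        moreover have "S \<noteq> {0}" using card by auto
        ultimately obtain a where a: "a \<in> S" "a \<noteq> 0" by blast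
        then have "0 \<in> closure (hyp_arc a 0)"
          unfolding hyp_arc_eq_spectral_range by (intro zero_in_closure_spectral_range [of _ a]) auto
        moreover have "hyp_arc a 0 \<subseteq> \<Union>D"
          using a \<open>0 \<in> S\<close> by (auto simp: D_def arcs_def)
        ultimately show ?thesis unfolding E_def \<open>x = 0\<close> using closure_mono by blast
      qed
    qed
    moreover have "bounded (spectral_range S)"
      using compact_imp_bounded [OF cpt] bounded_subset by blast
    ultimately have "w \<in> inside E" using w wE mem_inside_of_bounded_region by blast
    then show ?thesis using D unfolding enclosed_def E_def by blast
  qed
qed

text \<open>If the origin belongs to the range while zero is an eigenvalue, then it belongs already to
  the range of the nonzero eigenvalues. The arcs of these are closed, so that the origin is on one of
  their curves or surrounded by them.\<close>

lemma spectral_range_subset_enclosed: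
  assumes fin: "finite S" and card: "card S \<ge> 2"
  shows "spectral_range S \<subseteq> enclosed (arcs S \<union> bitangent_segments S)"
proof
  fix w assume w: "w \<in> spectral_range S"
  show "w \<in> enclosed (arcs S \<union> bitangent_segments S)"
  proof (cases "w \<noteq> 0 \<or> 0 \<notin> S")
    case True
    then show ?thesis using spectral_range_point_enclosed [OF fin card w] by blast
  next
    case False
    let ?T = "S - {0}"
    have "0 \<in> convex hull ?T" using w False zero_in_spectral_range_iff [OF fin] by blast
    then have "?T \<noteq> {}" by (metis convex_hull_empty empty_iff)
    then have "card ?T \<noteq> 0" using fin by simp
    moreover have "card ?T \<noteq> 1"
    proof
      assume "card ?T = 1"
      then obtain a where a: "?T = {a}" by (rule card_1_singletonE)
      then have "a = 0" using \<open>0 \<in> convex hull ?T\<close> by simp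
      then show False using a by blast
    qed
    ultimately have card2: "card ?T \<ge> 2" by linarith
    have "0 \<in> spectral_range ?T"
      using \<open>0 \<in> convex hull ?T\<close> zero_in_spectral_range_iff [of ?T] fin by simp
    then have "0 \<in> enclosed (arcs ?T \<union> bitangent_segments ?T)"
      using fin card2 by (intro spectral_range_point_enclosed) auto
    moreover have "arcs ?T \<union> bitangent_segments ?T \<subseteq> arcs S \<union> bitangent_segments S"
      by (intro Un_mono arcs_mono bitangent_segments_mono) auto
    ultimately show ?thesis using False enclosed_mono by blast
  qed
qed

lemma enclosed_subset_spectral_range:
  assumes fin: "finite S"
  shows "enclosed (arcs S \<union> bitangent_segments S) \<subseteq> spectral_range S"
proof -
  let ?C = "arcs S \<union> bitangent_segments S"
  have "X \<subseteq> spectral_range S" if X: "X \<in> arcs S" for X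
  proof -
    obtain a b where "X = spectral_range {a, b}" "a \<in> S" "b \<in> S"
      using X unfolding arcs_def hyp_arc_eq_spectral_range by blast
    then show ?thesis by (simp add: spectral_range_mono)
  qed
  moreover have "X \<subseteq> spectral_range S" if X: "X \<in> bitangent_segments S" for X
  proof -
    obtain p q L a b c where X: "X = closed_segment p q" and abc: "a \<in> S" "b \<in> S" "c \<in> S"
      and ne: "a \<noteq> b" "b \<noteq> c" and t: "tangent_line_at L a b p" "tangent_line_at L b c q"
      using X unfolding bitangent_segments_def by blast
    have "X \<subseteq> spectral_range {a, b, c}" unfolding X by (rule bitangent_segment_subset [OF t ne])
    also have "\<dots> \<subseteq> spectral_range S" using abc by (intro spectral_range_mono) auto
    finally show ?thesis .
  qed
  ultimately have C: "\<Union>?C \<subseteq> spectral_range S" by blast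
  have "inside (closure (\<Union>D)) \<subseteq> spectral_range S" if "D \<subseteq> ?C" for D
  proof (rule inside_subset_spectral_range [OF fin])
    have D: "\<Union>D \<subseteq> spectral_range S" using C that by blast
    then show "closure (\<Union>D) \<subseteq> insert 0 (spectral_range S)"
      using compact_insert_zero_spectral_range [OF fin] by (intro closure_minimal compact_imp_closed) auto
    show "closure (\<Union>D) \<subseteq> spectral_range S" if "0 \<notin> S"
      using D compact_spectral_range [OF fin that] by (intro closure_minimal compact_imp_closed)
  qed
  then show ?thesis using C unfolding enclosed_def by blast
qed

section \<open>The normalized numerical range\<close>

lemma not_invertible_if_zero_eigenvalue:
  assumes "0 \<in> eigenvalues A"
  shows "\<not> invertible A"
proof
  assume "invertible A"
  then obtain B where "B ** A = mat 1" by (auto simp: invertible_def)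
  then have "A *v v = 0 \<Longrightarrow> v = 0" for v
    by (metis matrix_vector_mul_assoc matrix_vector_mul_lid matrix_vector_mult_0_right)
  then show False using assms by (auto simp: eigenvalues_def)
qed

theorem theorem4p4:
  fixes A :: "complex^'n^'n" and lam :: "nat \<Rightarrow> complex" and m :: nat
  assumes "normal_matrix A"
    and "inj_on lam {1..m}"
    and "lam ` {1..m} = eigenvalues A"
  shows "(m \<ge> 2 \<longrightarrow>
           norm_num_range A =
             enclosed (arcs (lam ` {1..m}) \<union> bitangent_segments (lam ` {1..m}))) \<and>
         (closed (norm_num_range A) \<or>
           (\<not> invertible A \<and> 0 \<notin> convex hull {lam i | i. i \<in> {1..m} \<and> lam i \<noteq> 0} \<and>
            closed (insert 0 (norm_num_range A))))"
proof
  define S where "S = lam ` {1..m}"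
  have fin: "finite S" by (simp add: S_def)
  have W: "norm_num_range A = spectral_range S"
    using norm_num_range_normal [OF assms(1)] assms(3) fin by (simp add: S_def)
  have card: "card S = m" using card_image [OF assms(2)] by (simp add: S_def)
  show "m \<ge> 2 \<longrightarrow> norm_num_range A =
      enclosed (arcs (lam ` {1..m}) \<union> bitangent_segments (lam ` {1..m}))"
    using spectral_range_subset_enclosed [OF fin] enclosed_subset_spectral_range [OF fin] card
    unfolding W S_def [symmetric] by blast
  have nz: "{lam i | i. i \<in> {1..m} \<and> lam i \<noteq> 0} = S - {0}" by (auto simp: S_def)
  have cl: "closed (insert 0 (norm_num_range A))"
    unfolding W using compact_insert_zero_spectral_range [OF fin] by (rule compact_imp_closed)
  show "closed (norm_num_range A) \<or>
      (\<not> invertible A \<and> 0 \<notin> convex hull {lam i | i. i \<in> {1..m} \<and> lam i \<noteq> 0} \<and>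
       closed (insert 0 (norm_num_range A)))"
  proof (cases "0 \<in> S \<and> 0 \<notin> spectral_range S")
    case True
    then have "\<not> invertible A" using not_invertible_if_zero_eigenvalue unfolding S_def assms(3) by blast
    moreover have "0 \<notin> convex hull (S - {0})" using True zero_in_spectral_range_iff [OF fin] by blast
    ultimately show ?thesis using cl unfolding nz by blast
  next
    case False
    then have "closed (norm_num_range A)"
      using cl compact_imp_closed [OF compact_spectral_range [OF fin]] unfolding W by (auto simp: insert_absorb)
    then show ?thesis ..
  qed
qed

end
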